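(* Let $\mathbb{C}$ be a modified category of interest and let $\phi:S\to R$ be a morphism in $\mathbb{C}$. Then the pullback crossed module construction along $\phi$ gives a functor $$\phi^\star:\mathbf{XMod/R}\to\mathbf{XMod/S},\qquad (P,R,\partial)\mapsto(\phi^\star(P),S,\partial^\star).$$ Moreover, for every crossed module $(P,R,\partial)$ in $\mathbb{C}$, the square formed by $\phi':\phi^\star(P)\to P$, $\partial:P\to R$, $\partial^\star:\phi^\star(P)\to S$ and $\phi:S\to R$, with $\partial\phi'=\phi\partial^\star$, is a pullback diagram.
   Context: **Modified category of interest (MCI).** Let $\mathbb{C}$ be a category of groups with a set of operations $\Omega$ and a set of identities $\mathbb{E}$ including the group identities. Let $\Omega_i$ be the set of $i$-ary operations in $\Omega$. $\mathbb{C}$ is an MCI if: (a) $\Omega=\Omega_0\cup\Omega_1\cup\Omega_2$; (b) the group operations (written additively, $0,-,+$, not necessarily commutative) are elements of $\Omega_0,\Omega_1,\Omega_2$ respectively; put $\Omega_2'=\Omega_2\setminus\{+\}$, $\Omega_1'=\Omega_1\setminus\{-\}$; if $\ast\in\Omega_2'$ then $\Omega_2'$ also contains $\ast^\circ$ defined by $x\ast^\circ y=y\ast x$; and $\Omega_0=\{0\}$; (c) for each $\ast\in\Omega_2'$, $\mathbb{E}$ includes $x\ast(y+z)=x\ast y+x\ast z$; (d) for each $\omega\in\Omega_1'$ and $\ast\in\Omega_2'$, $\mathbb{E}$ includes $\omega(x+y)=\omega(x)+\omega(y)$ and either $\omega(x\ast y)=\omega(x)\ast\omega(y)$ or $\omega(x\ast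 y)=\omega(x)\ast y$; and for every object $C$ and $x_1,x_2,x_3\in C$: (e) $x_1+(x_2\ast x_3)=(x_2\ast x_3)+x_1$ for each $\ast\in\Omega_2'$; (f) for each ordered pair $(\ast,\overline{\ast})\in\Omega_2'\times\Omega_2'$ there is a word $W$ such that $(x_1\ast x_2)\,\overline{\ast}\,x_3=W\big(x_1(x_2x_3),x_1(x_3x_2),(x_2x_3)x_1,(x_3x_2)x_1,x_2(x_1x_3),x_2(x_3x_1),(x_1x_3)x_2,(x_3x_1)x_2\big)$, where each juxtaposition represents an operation in $\Omega_2'$. Morphisms of $\mathbb{C}$ are maps preserving $+$ and all $\ast\in\Omega_2'$ and commuting with all $\omega\in\Omega_1'$. Products and fiber products in $\mathbb{C}$ carry componentwise operations. **Derived actions.** A split extension of $B$ by $A$ is a sequence $0\to A\xrightarrow{i}E\xrightarrow{p}B\to 0$ in $\mathbb{C}$ with $p$ surjective, $i$ the kernel of $p$, and a morphism $s:B\to E$ with $ps=1_B$. It induces the action of $B$ on $A$ given by $b\cdot a=s(b)+a-s(b)$ and $b\ast a=s(b)\ast a$ for $b\in B$, $a\in A$, $\ast\in\Omega_2'$. Actions arising this way are called derived actions. **Crossed modules.** A crossed module $(C_1,C_0,\partial)$ in $\mathbb{C}$ is a morphism $\partial:C_1\to C_0$ with a derived action of $C_0$ on $C_1$ such that for all $c_0\in C_0$, $c_1,c_1'\in C_1$, $\ast\in\Omega_2'$: (XM1) $\partial(c_0\cdot c_1)=c_0+\partial(c_1)-c_0$ and $\partial(c_0\ast c_1)=c_0\ast\partial(c_1)$;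 (XM2) $\partial(c_1)\cdot c_1'=c_1+c_1'-c_1$ and $\partial(c_1)\ast c_1'=c_1\ast c_1'$. A morphism $(C_1,C_0,\partial)\to(C_1',C_0',\partial')$ is a pair $(\mu_1,\mu_0)$ of morphisms $\mu_1:C_1\to C_1'$, $\mu_0:C_0\to C_0'$ of $\mathbb{C}$ with $\partial'\mu_1=\mu_0\partial$, $\mu_1(c_0\cdot c_1)=\mu_0(c_0)\cdot\mu_1(c_1)$ and $\mu_1(c_0\ast c_1)=\mu_0(c_0)\ast\mu_1(c_1)$ for all $c_0,c_1,\ast$. **Crossed $X$-modules.** For an object $X$ of $\mathbb{C}$, $\mathbf{XMod/X}$ is the category whose objects are the crossed modules in $\mathbb{C}$ with codomain $X$ and whose morphisms are the crossed module morphisms of the form $(\alpha,\mathrm{id}_X)$. **Pullback crossed module.** For a crossed module $(P,R,\partial)$ and a morphism $\phi:S\to R$, put $\phi^\star(P)=P\times_RS=\{(p,s)\mid\partial(p)=\phi(s)\}$, $\partial^\star(p,s)=s$, $\phi'(p,s)=p$, with $S$ acting on $\phi^\star(P)$ by $t\cdot(p,s)=(\phi(t)\cdot p,t+s-t)$ and $t\ast(p,s)=(\phi(t)\ast p,t\ast s)$. The pullback crossed module is $(\phi^\star(P),S,\partial^\star)$ with the crossed module morphism $(\phi',\phi)$ to $(P,R,\partial)$; it is characterized by the universal property that every crossed module morphism $(f,\phi):(X,S,\mu)\to(P,R,\partial)$ factors uniquely as $(\phi',\phi)\circ(f^\star,\mathrm{id}_S)$ with $(f^\star,\mathrm{id}_S):(X,S,\mu)\to(\phi^\star(P),S,\partial^\star)$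 a crossed module morphism. *)

theory Defs
  imports "HOL-Algebra.Coset"
begin

section \<open>Groups with operations and identities\<close>

text \<open>
  The operations \<open>0\<close>, \<open>-\<close>, \<open>+\<close> are always present, so a signature only lists the
  remaining unary and binary operations \<open>\<Omega>\<^sub>1'\<close> and \<open>\<Omega>\<^sub>2'\<close>; both sets may be empty.
\<close>

record ('u, 'b) signature =
  un :: "'u set"
  bin :: "'b set"

text \<open>
  The underlying (not necessarily commutative) group is a group of HOL-Algebra and hence
  written multiplicatively: \<open>\<otimes>\<close>, \<open>\<one>\<close>, \<open>inv\<close> are the paper's \<open>+\<close>, \<open>0\<close>, \<open>-\<close>.
\<close>

record ('a, 'u, 'b) ogroup = "'a monoid" +
  uop :: "'u \<Rightarrow> 'a \<Rightarrow> 'a"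
  bop :: "'b \<Rightarrow> 'a \<Rightarrow> 'a \<Rightarrow> 'a"

datatype (uops: 'u, bops: 'b) trm =
    Var nat
  | Zero
  | Neg "('u, 'b) trm"
  | Add "('u, 'b) trm" "('u, 'b) trm"
  | UOp 'u "('u, 'b) trm"
  | BOp 'b "('u, 'b) trm" "('u, 'b) trm"

definition trm_over :: "('u, 'b) signature \<Rightarrow> ('u, 'b) trm \<Rightarrow> bool" where
  "trm_over \<Omega> t \<longleftrightarrow> uops t \<subseteq> un \<Omega> \<and> bops t \<subseteq> bin \<Omega>"

primrec eval :: "('a, 'u, 'b) ogroup \<Rightarrow> (nat \<Rightarrow> 'a) \<Rightarrow> ('u, 'b) trm \<Rightarrow> 'a" where
  "eval A v (Var n) = v n"
| "eval A v Zero = \<one>\<^bsub>A\<^esub>"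
| "eval A v (Neg t) = inv\<^bsub>A\<^esub> (eval A v t)"
| "eval A v (Add s t) = eval A v s \<otimes>\<^bsub>A\<^esub> eval A v t"
| "eval A v (UOp w t) = uop A w (eval A v t)"
| "eval A v (BOp m s t) = bop A m (eval A v s) (eval A v t)"

primrec subst :: "(nat \<Rightarrow> ('u, 'b) trm) \<Rightarrow> ('u, 'b) trm \<Rightarrow> ('u, 'b) trm" where
  "subst f (Var n) = f n"
| "subst f Zero = Zero"
| "subst f (Neg t) = Neg (subst f t)"
| "subst f (Add s t) = Add (subst f s) (subst f t)"
| "subst f (UOp w t) = UOp w (subst f t)"
| "subst f (BOp m s t) = BOp m (subst f s) (subst f t)"

type_synonym ('u, 'b) identity = "('u, 'b) trm \<times> ('u, 'b) trm"

definition satisfies :: "('a, 'u, 'b) ogroup \<Rightarrow> ('u, 'b) identity \<Rightarrow> bool" where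
  "satisfies A e \<longleftrightarrow>
     (\<forall>v. (\<forall>n. v n \<in> carrier A) \<longrightarrow> eval A v (fst e) = eval A v (snd e))"

text \<open>
  The objects of the category given by \<open>\<Omega>\<close> and \<open>E\<close>, over an arbitrary carrier type.
  The group identities need not be listed in \<open>E\<close>.
\<close>

definition object ::
  "('u, 'b) signature \<Rightarrow> ('u, 'b) identity set \<Rightarrow> ('a, 'u, 'b) ogroup \<Rightarrow> bool" where
  "object \<Omega> E A \<longleftrightarrow> group A
     \<and> (\<forall>w\<in>un \<Omega>. uop A w \<in> carrier A \<rightarrow> carrier A)
     \<and> (\<forall>m\<in>bin \<Omega>. bop A m \<in> carrier A \<rightarrow> carrier A \<rightarrow> carrier A)
     \<and> (\<forall>e\<in>E. satisfies A e)"

text \<open>Morphisms are extensional, so that equality of morphisms is equality of functions.\<close>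

definition mor ::
  "('u, 'b) signature \<Rightarrow> ('a, 'u, 'b) ogroup \<Rightarrow> ('c, 'u, 'b) ogroup \<Rightarrow> ('a \<Rightarrow> 'c) set" where
  "mor \<Omega> A B = {f \<in> hom A B \<inter> extensional (carrier A).
     (\<forall>w\<in>un \<Omega>. \<forall>x\<in>carrier A. f (uop A w x) = uop B w (f x)) \<and>
     (\<forall>m\<in>bin \<Omega>. \<forall>x\<in>carrier A. \<forall>y\<in>carrier A. f (bop A m x y) = bop B m (f x) (f y))}"

definition idm :: "('a, 'u, 'b) ogroup \<Rightarrow> 'a \<Rightarrow> 'a" where
  "idm A = (\<lambda>x\<in>carrier A. x)"

text \<open>
  \<open>valid \<Omega> E e\<close>: the identity \<open>e\<close> holds in every object. A predicate cannot quantify over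
  the carrier type, so the objects here have carriers consisting of sets of terms; by
  \<open>valid_imp_satisfies\<close> below, \<open>e\<close> then holds in every object over every type.
\<close>

definition valid ::
  "('u, 'b) signature \<Rightarrow> ('u, 'b) identity set \<Rightarrow> ('u, 'b) identity \<Rightarrow> bool" where
  "valid \<Omega> E e \<longleftrightarrow>
     (\<forall>A :: (('u, 'b) trm set, 'u, 'b) ogroup. object \<Omega> E A \<longrightarrow> satisfies A e)"


text \<open>
  \<open>transport f D A\<close> carries the structure of the subobject \<open>D\<close> of \<open>A\<close> along the injection \<open>f\<close>.
  It is used only to show that fixing the carrier type in \<open>valid\<close> and, later, in
  \<open>derived_action\<close> loses nothing.
\<close>

definition transport :: "('a \<Rightarrow> 'c) \<Rightarrow> 'a set \<Rightarrow> ('a, 'u, 'b) ogroup \<Rightarrow> ('c, 'u, 'b) ogroup" where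
  "transport f D A = (let g = inv_into D f in
     \<lparr>carrier = f ` D,
      mult = (\<lambda>x y. f (g x \<otimes>\<^bsub>A\<^esub> g y)),
      one = f \<one>\<^bsub>A\<^esub>,
      uop = (\<lambda>w x. f (uop A w (g x))),
      bop = (\<lambda>m x y. f (bop A m (g x) (g y)))\<rparr>)"

lemma transport_simps [simp]:
  "carrier (transport f D A) = f ` D"
  "x \<otimes>\<^bsub>transport f D A\<^esub> y = f (inv_into D f x \<otimes>\<^bsub>A\<^esub> inv_into D f y)"
  "\<one>\<^bsub>transport f D A\<^esub> = f \<one>\<^bsub>A\<^esub>"
  "uop (transport f D A) w x = f (uop A w (inv_into D f x))"
  "bop (transport f D A) m x y = f (bop A m (inv_into D f x) (inv_into D f y))"
  by (simp_all add: transport_def Let_def)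

context
  fixes \<Omega> :: "('u, 'b) signature" and E :: "('u, 'b) identity set"
    and A :: "('a, 'u, 'b) ogroup" and D :: "'a set" and f :: "'a \<Rightarrow> 'c"
  assumes A: "object \<Omega> E A"
    and D: "subgroup D A"
    and D_un: "\<And>w x. w \<in> un \<Omega> \<Longrightarrow> x \<in> D \<Longrightarrow> uop A w x \<in> D"
    and D_bin: "\<And>m x y. m \<in> bin \<Omega> \<Longrightarrow> x \<in> D \<Longrightarrow> y \<in> D \<Longrightarrow> bop A m x y \<in> D"
    and f: "inj_on f D"
begin

lemma group_transport: "group (transport f D A)"
proof -
  interpret A: group A using A by (simp add: object_def)
  interpret D: subgroup D A by (rule D)
  note [simp] = inv_into_f_f[OF f] D.mem_carrier
  show ?thesis
  proof (rule groupI)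
    fix x assume "x \<in> carrier (transport f D A)"
    then obtain d where d: "d \<in> D" "x = f d" by auto
    then show "\<exists>y\<in>carrier (transport f D A).
        y \<otimes>\<^bsub>transport f D A\<^esub> x = \<one>\<^bsub>transport f D A\<^esub>"
      by (intro bexI[of _ "f (inv\<^bsub>A\<^esub> d)"]) auto
  qed (auto simp: A.m_assoc)
qed

lemma inv_transport:
  assumes "x \<in> D" shows "inv\<^bsub>transport f D A\<^esub> (f x) = f (inv\<^bsub>A\<^esub> x)"
proof -
  interpret A: group A using A by (simp add: object_def)
  interpret D: subgroup D A by (rule D)
  interpret T: group "transport f D A" by (rule group_transport)
  show ?thesis
    by (rule T.inv_equality) (use assms D.mem_carrier in \<open>auto simp: inv_into_f_f[OF f]\<close>)
qed

lemma eval_transport: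
  assumes v: "\<And>n. v n \<in> D" and t: "trm_over \<Omega> t"
  shows "eval A v t \<in> D \<and> eval (transport f D A) (\<lambda>n. f (v n)) t = f (eval A v t)"
proof -
  interpret D: subgroup D A by (rule D)
  show ?thesis using t
    by (induction t)
      (auto simp: v trm_over_def inv_into_f_f[OF f] inv_transport intro: D_un D_bin)
qed

lemma object_transport:
  assumes E: "\<And>s t. (s, t) \<in> E \<Longrightarrow> trm_over \<Omega> s \<and> trm_over \<Omega> t"
  shows "object \<Omega> E (transport f D A)"
proof -
  interpret D: subgroup D A by (rule D)
  have "satisfies (transport f D A) (s, t)" if "(s, t) \<in> E" for s t
    unfolding satisfies_def
  proof (intro allI impI)
    fix v :: "nat \<Rightarrow> 'c" assume v: "\<forall>n. v n \<in> carrier (transport f D A)"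
    define u where "u n = inv_into D f (v n)" for n :: nat
    have u: "u n \<in> D" "f (u n) = v n" for n
      using v by (auto simp: u_def intro!: inv_into_into f_inv_into_f)
    have "eval A u s = eval A u t"
      using A that u(1) D.mem_carrier by (fastforce simp: object_def satisfies_def)
    moreover have "v = (\<lambda>n. f (u n))" by (simp add: u)
    ultimately show "eval (transport f D A) v (fst (s, t)) = eval (transport f D A) v (snd (s, t))"
      using eval_transport[of u] u(1) E[OF that] by simp
  qed
  then show ?thesis
    unfolding object_def
    by (auto simp: group_transport inv_into_f_f[OF f] intro: D_un D_bin)
qed

end

theorem valid_imp_satisfies:
  fixes A :: "('a, 'u, 'b) ogroup"
  assumes E: "\<And>s t. (s, t) \<in> E \<Longrightarrow> trm_over \<Omega> s \<and> trm_over \<Omega> t"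
    and st: "trm_over \<Omega> s" "trm_over \<Omega> t"
    and valid: "valid \<Omega> E (s, t)" and A: "object \<Omega> E A"
  shows "satisfies A (s, t)"
  unfolding satisfies_def
proof (intro allI impI)
  fix v :: "nat \<Rightarrow> 'a" assume v: "\<forall>n. v n \<in> carrier A"
  interpret A: group A using A by (simp add: object_def)
  define D where "D = eval A v ` {t. trm_over \<Omega> t}"
  define f where "f x = {t. trm_over \<Omega> t \<and> eval A v t = x}" for x
  have closed: "eval A v t \<in> carrier A" if "trm_over \<Omega> t" for t
    using that A v by (induction t) (auto simp: trm_over_def object_def Pi_iff)
  have D: "subgroup D A"
  proof (rule A.subgroupI)
    show "D \<subseteq> carrier A" using closed by (auto simp: D_def)
    have "trm_over \<Omega> Zero" by (simp add: trm_over_def)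
    then show "D \<noteq> {}" by (auto simp: D_def)
    fix x y assume "x \<in> D" "y \<in> D"
    then obtain a b where ab: "trm_over \<Omega> a" "trm_over \<Omega> b" "x = eval A v a" "y = eval A v b"
      by (auto simp: D_def)
    then have "trm_over \<Omega> (Neg a)" "trm_over \<Omega> (Add a b)" by (auto simp: trm_over_def)
    then have "eval A v (Neg a) \<in> D" "eval A v (Add a b) \<in> D" unfolding D_def by blast+
    then show "inv\<^bsub>A\<^esub> x \<in> D" "x \<otimes>\<^bsub>A\<^esub> y \<in> D" by (simp_all add: ab)
  qed
  have D_un: "uop A w x \<in> D" if w: "w \<in> un \<Omega>" and x: "x \<in> D" for w x
  proof -
    obtain a where a: "trm_over \<Omega> a" "x = eval A v a" using x by (auto simp: D_def)
    then have "trm_over \<Omega> (UOp w a)" using w by (auto simp: trm_over_def)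
    then have "eval A v (UOp w a) \<in> D" unfolding D_def by blast
    then show ?thesis by (simp add: a)
  qed
  have D_bin: "bop A m x y \<in> D" if m: "m \<in> bin \<Omega>" and xy: "x \<in> D" "y \<in> D" for m x y
  proof -
    obtain a b where ab: "trm_over \<Omega> a" "trm_over \<Omega> b" "x = eval A v a" "y = eval A v b"
      using xy by (auto simp: D_def)
    then have "trm_over \<Omega> (BOp m a b)" using m by (auto simp: trm_over_def)
    then have "eval A v (BOp m a b) \<in> D" unfolding D_def by blast
    then show ?thesis by (simp add: ab)
  qed
  have f: "inj_on f D" by (force simp: inj_on_def D_def f_def)
  have vD: "v n \<in> D" for n
  proof -
    have "trm_over \<Omega> (Var n)" by (simp add: trm_over_def)
    then have "eval A v (Var n) \<in> D" unfolding D_def by blast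
    then show ?thesis by simp
  qed
  note tr = A D D_un D_bin f
  have "object \<Omega> E (transport f D A)"
    using object_transport[OF tr] E by blast
  then have "satisfies (transport f D A) (s, t)" using valid by (simp add: valid_def)
  then have "eval (transport f D A) (\<lambda>n. f (v n)) s = eval (transport f D A) (\<lambda>n. f (v n)) t"
    using vD by (auto simp: satisfies_def)
  moreover have "eval (transport f D A) (\<lambda>n. f (v n)) s = f (eval A v s)" "eval A v s \<in> D"
    "eval (transport f D A) (\<lambda>n. f (v n)) t = f (eval A v t)" "eval A v t \<in> D"
    using eval_transport[OF tr, where v = v] vD st by blast+
  ultimately show "eval A v (fst (s, t)) = eval A v (snd (s, t))"
    using f by (auto dest: inj_onD)
qed


section \<open>Modified categories of interest\<close>

text \<open>
  The arguments of the word \<open>W\<close>: \<open>x\<^sub>1(x\<^sub>2x\<^sub>3)\<close>, \<open>x\<^sub>1(x\<^sub>3x\<^sub>2)\<close>, \<open>x\<^sub>2(x\<^sub>1x\<^sub>3)\<close>, \<open>x\<^sub>2(x\<^sub>3x\<^sub>1)\<close> and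
  \<open>(x\<^sub>2x\<^sub>3)x\<^sub>1\<close>, \<open>(x\<^sub>3x\<^sub>2)x\<^sub>1\<close>, \<open>(x\<^sub>1x\<^sub>3)x\<^sub>2\<close>, \<open>(x\<^sub>3x\<^sub>1)x\<^sub>2\<close>, each juxtaposition being any binary
  operation other than \<open>+\<close>, independently of the others.
\<close>

definition triple_products :: "('u, 'b) signature \<Rightarrow> ('u, 'b) trm set" where
  "triple_products \<Omega> =
     (\<Union>f\<in>bin \<Omega>. \<Union>g\<in>bin \<Omega>. \<Union>(i, j, k)\<in>{(1, 2, 3), (1, 3, 2), (2, 1, 3), (2, 3, 1)}.
        {BOp f (Var i) (BOp g (Var j) (Var k)), BOp f (BOp g (Var j) (Var k)) (Var i)})"

text \<open>
  An identity counts as included in \<open>E\<close> if it holds in all objects; it need not literally be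
  a member of \<open>E\<close>. Operations in \<open>un \<Omega>\<close> are additive even if \<open>bin \<Omega>\<close> is empty.
\<close>

locale modified_category_of_interest =
  fixes \<Omega> :: "('u, 'b) signature"
    and E :: "('u, 'b) identity set"
  assumes identities_over: "\<And>s t. (s, t) \<in> E \<Longrightarrow> trm_over \<Omega> s \<and> trm_over \<Omega> t"
    and opposite: "\<And>m. m \<in> bin \<Omega> \<Longrightarrow>
      \<exists>m'\<in>bin \<Omega>. valid \<Omega> E (BOp m' (Var 1) (Var 2), BOp m (Var 2) (Var 1))"
    and bin_distrib: "\<And>m. m \<in> bin \<Omega> \<Longrightarrow>
      valid \<Omega> E (BOp m (Var 1) (Add (Var 2) (Var 3)),
        Add (BOp m (Var 1) (Var 2)) (BOp m (Var 1) (Var 3)))"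
    and un_additive: "\<And>w. w \<in> un \<Omega> \<Longrightarrow>
      valid \<Omega> E (UOp w (Add (Var 1) (Var 2)), Add (UOp w (Var 1)) (UOp w (Var 2)))"
    and un_bin: "\<And>w m. w \<in> un \<Omega> \<Longrightarrow> m \<in> bin \<Omega> \<Longrightarrow>
      valid \<Omega> E (UOp w (BOp m (Var 1) (Var 2)), BOp m (UOp w (Var 1)) (UOp w (Var 2))) \<or>
      valid \<Omega> E (UOp w (BOp m (Var 1) (Var 2)), BOp m (UOp w (Var 1)) (Var 2))"
    and bin_central: "\<And>m. m \<in> bin \<Omega> \<Longrightarrow>
      valid \<Omega> E (Add (Var 1) (BOp m (Var 2) (Var 3)), Add (BOp m (Var 2) (Var 3)) (Var 1))"
    and word: "\<And>m n. m \<in> bin \<Omega> \<Longrightarrow> n \<in> bin \<Omega> \<Longrightarrow>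
      \<exists>W arg. trm_over \<Omega> W \<and> range arg \<subseteq> triple_products \<Omega> \<and>
        valid \<Omega> E (BOp n (BOp m (Var 1) (Var 2)) (Var 3), subst arg W)"


section \<open>Derived actions\<close>

definition split_extension ::
  "('u, 'b) signature \<Rightarrow> ('u, 'b) identity set \<Rightarrow> ('a, 'u, 'b) ogroup \<Rightarrow> ('x, 'u, 'b) ogroup
    \<Rightarrow> ('c, 'u, 'b) ogroup \<Rightarrow> ('a \<Rightarrow> 'x) \<Rightarrow> ('x \<Rightarrow> 'c) \<Rightarrow> ('c \<Rightarrow> 'x) \<Rightarrow> bool" where
  "split_extension \<Omega> E A X B i p s \<longleftrightarrow>
     object \<Omega> E A \<and> object \<Omega> E X \<and> object \<Omega> E B \<and>
     i \<in> mor \<Omega> A X \<and> p \<in> mor \<Omega> X B \<and> s \<in> mor \<Omega> B X \<and>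
     p ` carrier X = carrier B \<and>
     inj_on i (carrier A) \<and> i ` carrier A = kernel X B p \<and>
     (\<forall>b\<in>carrier B. p (s b) = b)"

text \<open>
  An action of \<open>B\<close> on \<open>A\<close> consists of \<open>b \<cdot> a = act b a\<close> and \<open>b \<ast> a = star m b a\<close>, where
  \<open>m\<close> names the operation \<open>\<ast>\<close>. Since \<open>A\<close> is identified with its image under \<open>i\<close>, the
  defining equations are stated after applying \<open>i\<close>.
\<close>

definition induced_action ::
  "('u, 'b) signature \<Rightarrow> ('a, 'u, 'b) ogroup \<Rightarrow> ('x, 'u, 'b) ogroup \<Rightarrow> ('c, 'u, 'b) ogroup
    \<Rightarrow> ('a \<Rightarrow> 'x) \<Rightarrow> ('c \<Rightarrow> 'x) \<Rightarrow> ('c \<Rightarrow> 'a \<Rightarrow> 'a) \<Rightarrow> ('b \<Rightarrow> 'c \<Rightarrow> 'a \<Rightarrow> 'a) \<Rightarrow> bool" where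
  "induced_action \<Omega> A X B i s act star \<longleftrightarrow>
     (\<forall>b\<in>carrier B. \<forall>a\<in>carrier A.
        act b a \<in> carrier A \<and> i (act b a) = s b \<otimes>\<^bsub>X\<^esub> i a \<otimes>\<^bsub>X\<^esub> inv\<^bsub>X\<^esub> (s b)) \<and>
     (\<forall>m\<in>bin \<Omega>. \<forall>b\<in>carrier B. \<forall>a\<in>carrier A.
        star m b a \<in> carrier A \<and> i (star m b a) = bop X m (s b) (i a))"

text \<open>
  The split extension is sought with a carrier of pairs. This is no restriction: see
  \<open>derived_actionI\<close> below.
\<close>

definition derived_action ::
  "('u, 'b) signature \<Rightarrow> ('u, 'b) identity set \<Rightarrow> ('a, 'u, 'b) ogroup \<Rightarrow> ('c, 'u, 'b) ogroup
    \<Rightarrow> ('c \<Rightarrow> 'a \<Rightarrow> 'a) \<Rightarrow> ('b \<Rightarrow> 'c \<Rightarrow> 'a \<Rightarrow> 'a) \<Rightarrow> bool" where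
  "derived_action \<Omega> E A B act star \<longleftrightarrow>
     (\<exists>(X :: ('a \<times> 'c, 'u, 'b) ogroup) i p s.
        split_extension \<Omega> E A X B i p s \<and> induced_action \<Omega> A X B i s act star)"


theorem derived_actionI:
  fixes X :: "('x, 'u, 'b) ogroup" and A :: "('a, 'u, 'b) ogroup" and B :: "('c, 'u, 'b) ogroup"
  assumes E: "\<And>s t. (s, t) \<in> E \<Longrightarrow> trm_over \<Omega> s \<and> trm_over \<Omega> t"
    and se: "split_extension \<Omega> E A X B i p s"
    and ia: "induced_action \<Omega> A X B i s act star"
  shows "derived_action \<Omega> E A B act star"
proof -
  have A: "object \<Omega> E A" and X: "object \<Omega> E X" and B: "object \<Omega> E B"
    and i: "i \<in> mor \<Omega> A X" and p: "p \<in> mor \<Omega> X B" and s: "s \<in> mor \<Omega> B X"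
    and psurj: "p ` carrier X = carrier B"
    and iinj: "inj_on i (carrier A)" and iker: "i ` carrier A = kernel X B p"
    and ps: "\<And>b. b \<in> carrier B \<Longrightarrow> p (s b) = b"
    using se by (auto simp: split_extension_def)
  interpret A: group A using A by (simp add: object_def)
  interpret X: group X using X by (simp add: object_def)
  interpret B: group B using B by (simp add: object_def)
  interpret p: group_hom X B p using p by unfold_locales (simp add: mor_def)
  interpret s: group_hom B X s using s by unfold_locales (simp add: mor_def)
  define f where "f x = (inv_into (carrier A) i (x \<otimes>\<^bsub>X\<^esub> inv\<^bsub>X\<^esub> (s (p x))), p x)" for x
  have f: "inj_on f (carrier X)"
  proof (rule inj_onI)
    fix x y assume xy: "x \<in> carrier X" "y \<in> carrier X" "f x = f y"
    have *: "z \<otimes>\<^bsub>X\<^esub> inv\<^bsub>X\<^esub> (s (p z)) \<in> i ` carrier A" if "z \<in> carrier X" for z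
      using that by (simp add: iker kernel_def ps)
    have pe: "p x = p y" using xy by (simp add: f_def)
    have "inv_into (carrier A) i (x \<otimes>\<^bsub>X\<^esub> inv\<^bsub>X\<^esub> (s (p x)))
        = inv_into (carrier A) i (y \<otimes>\<^bsub>X\<^esub> inv\<^bsub>X\<^esub> (s (p y)))"
      using arg_cong[OF xy(3), of fst] unfolding f_def fst_conv .
    then have "x \<otimes>\<^bsub>X\<^esub> inv\<^bsub>X\<^esub> (s (p x)) = y \<otimes>\<^bsub>X\<^esub> inv\<^bsub>X\<^esub> (s (p y))"
      using *[of x] *[of y] xy by (meson inv_into_injective)
    then show "x = y" using xy pe by simp
  qed
  define Y where "Y = transport f (carrier X) X"
  have cu: "uop X w x \<in> carrier X" if "x \<in> carrier X" "w \<in> un \<Omega>" for w x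
    using X that by (auto simp: object_def Pi_iff)
  have cb: "bop X m x y \<in> carrier X" if "x \<in> carrier X" "y \<in> carrier X" "m \<in> bin \<Omega>" for m x y
    using X that by (auto simp: object_def Pi_iff)
  note tr = X X.subgroup_self cu cb f
  have Y: "object \<Omega> E Y"
    unfolding Y_def using E by (intro object_transport[OF tr]) auto
  have inv_Y: "inv\<^bsub>Y\<^esub> (f x) = f (inv\<^bsub>X\<^esub> x)" if "x \<in> carrier X" for x
    unfolding Y_def using that by (intro inv_transport[OF tr]) auto
  have icl: "i a \<in> carrier X" if "a \<in> carrier A" for a
    using i that by (auto simp: mor_def hom_def Pi_iff)
  have uA: "uop A w a \<in> carrier A" if "a \<in> carrier A" "w \<in> un \<Omega>" for w a
    using A that by (auto simp: object_def Pi_iff)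
  have bA: "bop A m a b \<in> carrier A" if "a \<in> carrier A" "b \<in> carrier A" "m \<in> bin \<Omega>" for m a b
    using A that by (auto simp: object_def Pi_iff)
  have uB: "uop B w a \<in> carrier B" if "a \<in> carrier B" "w \<in> un \<Omega>" for w a
    using B that by (auto simp: object_def Pi_iff)
  have bB: "bop B m a b \<in> carrier B" if "a \<in> carrier B" "b \<in> carrier B" "m \<in> bin \<Omega>" for m a b
    using B that by (auto simp: object_def Pi_iff)
  define i' where "i' = restrict (\<lambda>a. f (i a)) (carrier A)"
  define p' where "p' = restrict (\<lambda>y. p (inv_into (carrier X) f y)) (carrier Y)"
  define s' where "s' = restrict (\<lambda>b. f (s b)) (carrier B)"
  note [simp] = inv_into_f_f[OF f] icl uA bA uB bB cu cb
  have Y_simps [simp]: "carrier Y = f ` carrier X"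
    "\<And>x y. x \<in> carrier X \<Longrightarrow> y \<in> carrier X \<Longrightarrow> f x \<otimes>\<^bsub>Y\<^esub> f y = f (x \<otimes>\<^bsub>X\<^esub> y)"
    "\<And>w x. x \<in> carrier X \<Longrightarrow> uop Y w (f x) = f (uop X w x)"
    "\<And>m x y. x \<in> carrier X \<Longrightarrow> y \<in> carrier X \<Longrightarrow> bop Y m (f x) (f y) = f (bop X m x y)"
    by (simp_all add: Y_def)
  have i': "i' \<in> mor \<Omega> A Y"
    using i by (auto simp: mor_def hom_def i'_def)
  have s': "s' \<in> mor \<Omega> B Y"
    using s by (auto simp: mor_def hom_def s'_def)
  have p': "p' \<in> mor \<Omega> Y B"
    using p by (auto simp: mor_def hom_def p'_def)
  have "split_extension \<Omega> E A Y B i' p' s'"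
    unfolding split_extension_def
  proof (intro conjI A Y B i' p' s')
    have "p' ` carrier Y = p ` carrier X" by (simp add: p'_def image_image)
    then show "p' ` carrier Y = carrier B" by (simp add: psurj)
    show "inj_on i' (carrier A)"
      using iinj f by (auto simp: i'_def inj_on_def)
    have "kernel Y B p' = f ` kernel X B p"
      by (auto simp: kernel_def p'_def)
    then show "i' ` carrier A = kernel Y B p'"
      unfolding iker[symmetric] by (auto simp: i'_def image_iff)
    show "\<forall>b\<in>carrier B. p' (s' b) = b" using ps by (simp add: p'_def s'_def)
  qed
  moreover have "induced_action \<Omega> A Y B i' s' act star"
    using ia by (auto simp: induced_action_def i'_def s'_def inv_Y)
  ultimately show ?thesis unfolding derived_action_def by blast
qed


section \<open>Crossed modules\<close>

record ('p, 'r, 'u, 'b) xmod =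
  dom :: "('p, 'u, 'b) ogroup"
  cod :: "('r, 'u, 'b) ogroup"
  bd :: "'p \<Rightarrow> 'r"
  act :: "'r \<Rightarrow> 'p \<Rightarrow> 'p"
  star :: "'b \<Rightarrow> 'r \<Rightarrow> 'p \<Rightarrow> 'p"

definition crossed_module ::
  "('u, 'b) signature \<Rightarrow> ('u, 'b) identity set \<Rightarrow> ('p, 'r, 'u, 'b) xmod \<Rightarrow> bool" where
  "crossed_module \<Omega> E M \<longleftrightarrow>
     object \<Omega> E (dom M) \<and> object \<Omega> E (cod M) \<and> bd M \<in> mor \<Omega> (dom M) (cod M) \<and>
     derived_action \<Omega> E (dom M) (cod M) (act M) (star M) \<and>
     (\<forall>r\<in>carrier (cod M). \<forall>c\<in>carrier (dom M).
        bd M (act M r c) = r \<otimes>\<^bsub>cod M\<^esub> bd M c \<otimes>\<^bsub>cod M\<^esub> inv\<^bsub>cod M\<^esub> r \<and>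
        (\<forall>m\<in>bin \<Omega>. bd M (star M m r c) = bop (cod M) m r (bd M c))) \<and>
     (\<forall>c\<in>carrier (dom M). \<forall>c'\<in>carrier (dom M).
        act M (bd M c) c' = c \<otimes>\<^bsub>dom M\<^esub> c' \<otimes>\<^bsub>dom M\<^esub> inv\<^bsub>dom M\<^esub> c \<and>
        (\<forall>m\<in>bin \<Omega>. star M m (bd M c) c' = bop (dom M) m c c'))"

definition xmod_mor ::
  "('u, 'b) signature \<Rightarrow> ('p, 'r, 'u, 'b) xmod \<Rightarrow> ('q, 's, 'u, 'b) xmod
    \<Rightarrow> (('p \<Rightarrow> 'q) \<times> ('r \<Rightarrow> 's)) set" where
  "xmod_mor \<Omega> M N = {(f, g).
     f \<in> mor \<Omega> (dom M) (dom N) \<and> g \<in> mor \<Omega> (cod M) (cod N) \<and>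
     (\<forall>c\<in>carrier (dom M). bd N (f c) = g (bd M c)) \<and>
     (\<forall>r\<in>carrier (cod M). \<forall>c\<in>carrier (dom M).
        f (act M r c) = act N (g r) (f c) \<and>
        (\<forall>m\<in>bin \<Omega>. f (star M m r c) = star N m (g r) (f c)))}"


section \<open>Categories and functors\<close>

text \<open>Composition \<open>Comp X Y Z g f\<close> of \<open>f : X \<rightarrow> Y\<close> and \<open>g : Y \<rightarrow> Z\<close>; hom-sets need not be disjoint.\<close>

record ('o, 'm) category =
  Ob :: "'o set"
  Hom :: "'o \<Rightarrow> 'o \<Rightarrow> 'm set"
  Id :: "'o \<Rightarrow> 'm"
  Comp :: "'o \<Rightarrow> 'o \<Rightarrow> 'o \<Rightarrow> 'm \<Rightarrow> 'm \<Rightarrow> 'm"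

definition is_category :: "('o, 'm) category \<Rightarrow> bool" where
  "is_category C \<longleftrightarrow>
     (\<forall>X\<in>Ob C. Id C X \<in> Hom C X X) \<and>
     (\<forall>X\<in>Ob C. \<forall>Y\<in>Ob C. \<forall>Z\<in>Ob C. \<forall>f\<in>Hom C X Y. \<forall>g\<in>Hom C Y Z.
        Comp C X Y Z g f \<in> Hom C X Z) \<and>
     (\<forall>X\<in>Ob C. \<forall>Y\<in>Ob C. \<forall>f\<in>Hom C X Y.
        Comp C X X Y f (Id C X) = f \<and> Comp C X Y Y (Id C Y) f = f) \<and>
     (\<forall>X\<in>Ob C. \<forall>Y\<in>Ob C. \<forall>Z\<in>Ob C. \<forall>V\<in>Ob C.
        \<forall>f\<in>Hom C X Y. \<forall>g\<in>Hom C Y Z. \<forall>h\<in>Hom C Z V.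
        Comp C X Y V (Comp C Y Z V h g) f = Comp C X Z V h (Comp C X Y Z g f))"

definition is_functor ::
  "('o, 'm) category \<Rightarrow> ('o', 'm') category \<Rightarrow> ('o \<Rightarrow> 'o') \<Rightarrow> ('o \<Rightarrow> 'o \<Rightarrow> 'm \<Rightarrow> 'm') \<Rightarrow> bool" where
  "is_functor C D F0 F1 \<longleftrightarrow>
     is_category C \<and> is_category D \<and>
     (\<forall>X\<in>Ob C. F0 X \<in> Ob D) \<and>
     (\<forall>X\<in>Ob C. \<forall>Y\<in>Ob C. \<forall>f\<in>Hom C X Y. F1 X Y f \<in> Hom D (F0 X) (F0 Y)) \<and>
     (\<forall>X\<in>Ob C. F1 X X (Id C X) = Id D (F0 X)) \<and>
     (\<forall>X\<in>Ob C. \<forall>Y\<in>Ob C. \<forall>Z\<in>Ob C. \<forall>f\<in>Hom C X Y. \<forall>g\<in>Hom C Y Z.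
        F1 X Z (Comp C X Y Z g f) = Comp D (F0 X) (F0 Y) (F0 Z) (F1 Y Z g) (F1 X Y f))"

definition XMod_over ::
  "('u, 'b) signature \<Rightarrow> ('u, 'b) identity set \<Rightarrow> ('r, 'u, 'b) ogroup
    \<Rightarrow> (('p, 'r, 'u, 'b) xmod, ('p \<Rightarrow> 'p) \<times> ('r \<Rightarrow> 'r)) category" where
  "XMod_over \<Omega> E R =
     \<lparr>Ob = {M. crossed_module \<Omega> E M \<and> cod M = R},
      Hom = (\<lambda>M N. {(f, g). (f, g) \<in> xmod_mor \<Omega> M N \<and> g = idm R}),
      Id = (\<lambda>M. (idm (dom M), idm R)),
      Comp = (\<lambda>M N L (f', g') (f, g).
        (compose (carrier (dom M)) f' f, compose (carrier R) g' g))\<rparr>"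


section \<open>The pullback crossed module\<close>

definition fibre_product ::
  "('p, 'u, 'b) ogroup \<Rightarrow> ('s, 'u, 'b) ogroup \<Rightarrow> ('p \<Rightarrow> 'r) \<Rightarrow> ('s \<Rightarrow> 'r)
    \<Rightarrow> ('p \<times> 's, 'u, 'b) ogroup" where
  "fibre_product P S d \<phi> =
     \<lparr>carrier = {(p, s). p \<in> carrier P \<and> s \<in> carrier S \<and> d p = \<phi> s},
      mult = (\<lambda>(p, s) (p', s'). (p \<otimes>\<^bsub>P\<^esub> p', s \<otimes>\<^bsub>S\<^esub> s')),
      one = (\<one>\<^bsub>P\<^esub>, \<one>\<^bsub>S\<^esub>),
      uop = (\<lambda>w (p, s). (uop P w p, uop S w s)),
      bop = (\<lambda>m (p, s) (p', s'). (bop P m p p', bop S m s s'))\<rparr>"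

definition pullback_xmod ::
  "('s, 'u, 'b) ogroup \<Rightarrow> ('s \<Rightarrow> 'r) \<Rightarrow> ('p, 'r, 'u, 'b) xmod \<Rightarrow> ('p \<times> 's, 's, 'u, 'b) xmod" where
  "pullback_xmod S \<phi> M =
     \<lparr>dom = fibre_product (dom M) S (bd M) \<phi>,
      cod = S,
      bd = restrict snd (carrier (fibre_product (dom M) S (bd M) \<phi>)),
      act = (\<lambda>t (p, s). (act M (\<phi> t) p, t \<otimes>\<^bsub>S\<^esub> s \<otimes>\<^bsub>S\<^esub> inv\<^bsub>S\<^esub> t)),
      star = (\<lambda>m t (p, s). (star M m (\<phi> t) p, bop S m t s))\<rparr>"

definition pullback_proj ::
  "('s, 'u, 'b) ogroup \<Rightarrow> ('s \<Rightarrow> 'r) \<Rightarrow> ('p, 'r, 'u, 'b) xmod \<Rightarrow> 'p \<times> 's \<Rightarrow> 'p" where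
  "pullback_proj S \<phi> M = restrict fst (carrier (dom (pullback_xmod S \<phi> M)))"

text \<open>
  The morphism part of \<open>\<phi>\<^sup>\<star>\<close>: \<open>(\<alpha>, id)\<close> goes to \<open>((p, s) \<mapsto> (\<alpha> p, s), id)\<close>, which is the
  factorisation of \<open>(\<alpha> \<phi>', \<phi>)\<close> through the pullback of the target.
\<close>

definition pullback_arr ::
  "('s, 'u, 'b) ogroup \<Rightarrow> ('s \<Rightarrow> 'r) \<Rightarrow> ('p, 'r, 'u, 'b) xmod \<Rightarrow> ('p, 'r, 'u, 'b) xmod
    \<Rightarrow> ('p \<Rightarrow> 'p) \<times> ('r \<Rightarrow> 'r) \<Rightarrow> ('p \<times> 's \<Rightarrow> 'p \<times> 's) \<times> ('s \<Rightarrow> 's)" where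
  "pullback_arr S \<phi> M N = (\<lambda>(\<alpha>, \<beta>).
     (\<lambda>(p, s)\<in>carrier (dom (pullback_xmod S \<phi> M)). (\<alpha> p, s), idm S))"

text \<open>
  \<open>pullback_square TYPE('t) \<Omega> E Q P S R f' d' d f\<close>: the square with \<open>f' : Q \<rightarrow> P\<close>,
  \<open>d' : Q \<rightarrow> S\<close>, \<open>d : P \<rightarrow> R\<close>, \<open>f : S \<rightarrow> R\<close> commutes and is universal among the objects
  with carriers in \<open>'t\<close>.
\<close>

definition pullback_square ::
  "'t itself \<Rightarrow> ('u, 'b) signature \<Rightarrow> ('u, 'b) identity set
    \<Rightarrow> ('q, 'u, 'b) ogroup \<Rightarrow> ('p, 'u, 'b) ogroup \<Rightarrow> ('s, 'u, 'b) ogroup \<Rightarrow> ('r, 'u, 'b) ogroup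
    \<Rightarrow> ('q \<Rightarrow> 'p) \<Rightarrow> ('q \<Rightarrow> 's) \<Rightarrow> ('p \<Rightarrow> 'r) \<Rightarrow> ('s \<Rightarrow> 'r) \<Rightarrow> bool" where
  "pullback_square _ \<Omega> E Q P S R f' d' d f \<longleftrightarrow>
     object \<Omega> E Q \<and> object \<Omega> E P \<and> object \<Omega> E S \<and> object \<Omega> E R \<and>
     f' \<in> mor \<Omega> Q P \<and> d' \<in> mor \<Omega> Q S \<and> d \<in> mor \<Omega> P R \<and> f \<in> mor \<Omega> S R \<and>
     compose (carrier Q) d f' = compose (carrier Q) f d' \<and>
     (\<forall>(T :: ('t, 'u, 'b) ogroup) a c.
        object \<Omega> E T \<and> a \<in> mor \<Omega> T P \<and> c \<in> mor \<Omega> T S \<and>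
        compose (carrier T) d a = compose (carrier T) f c \<longrightarrow>
        (\<exists>!h. h \<in> mor \<Omega> T Q \<and>
           compose (carrier T) f' h = a \<and> compose (carrier T) d' h = c))"

end

theory Submission
  imports Defs
begin

text \<open>
  Almost everything about \<open>\<phi>\<^sup>\<star>\<close> is componentwise: its underlying square is an ordinary fibre
  product, which inherits the identities of its two factors
  (\<open>fibre_product_pullback_square\<close>), the crossed module equations hold because they hold in
  the given crossed module \<open>\<partial> : P \<rightarrow> R\<close> and for conjugation and multiplication in \<open>S\<close>, and the functor laws hold because the
  arrow part is \<open>\<alpha>\<close> on the first component and the identity on the second.

  The one point with content is that the componentwise action of \<open>S\<close> on \<open>Q = \<phi>\<^sup>\<star>(P)\<close> is a
  derived action, that is, comes from a split extension of \<open>S\<close> by \<open>Q\<close>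
  (\<open>pullback_derived_action\<close>). Let \<open>P \<rightarrow> X \<rightarrow> R\<close>, with projection \<open>\<pi>\<close> and section \<open>\<sigma>\<close>, be a split
  extension that induces the action of \<open>R\<close> on \<open>P\<close>. In a modified category of interest \<open>X\<close>
  behaves like a semidirect product: by distributivity, a pair of morphisms on \<open>P\<close> and \<open>R\<close>
  that respects the action extends to \<open>X\<close> (\<open>split_extension_extend\<close>). The first crossed
  module condition says that \<open>\<partial>\<close> and the identity of \<open>R\<close> are such a pair, so there is a
  morphism \<open>\<tau> : X \<rightarrow> R\<close> with \<open>\<tau> = \<partial>\<close> on \<open>P\<close> and \<open>\<tau> \<sigma> = 1\<close>; \<open>\<pi>\<close> and \<open>\<tau>\<close> are the source and
  target maps of the internal category that corresponds to the crossed module. Now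
  \<open>Z = {(x, t, u). \<pi> x = \<phi> t, \<tau> x = \<phi> u}\<close> is an object, being an iterated fibre product, and
  projects to \<open>S\<close> by \<open>(x, t, u) \<mapsto> t\<close>, split by \<open>t \<mapsto> (\<sigma> (\<phi> t), t, t)\<close>. An element of the kernel
  has \<open>t = 1\<close> and \<open>x \<in> P\<close>, so the condition that remains is \<open>\<partial> x = \<phi> u\<close>: the kernel is \<open>Q\<close>. The
  action of \<open>t\<close> is computed in \<open>X\<close> and in \<open>S\<close> separately, and gives the required formulas.
\<close>


section \<open>Objects and morphisms\<close>

lemma object_group: "object \<Omega> E A \<Longrightarrow> group A"
  by (simp add: object_def)

lemma object_uop_closed:
  "object \<Omega> E A \<Longrightarrow> w \<in> un \<Omega> \<Longrightarrow> x \<in> carrier A \<Longrightarrow> uop A w x \<in> carrier A"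
  by (auto simp: object_def Pi_iff)

lemma object_bop_closed:
  "object \<Omega> E A \<Longrightarrow> m \<in> bin \<Omega> \<Longrightarrow> x \<in> carrier A \<Longrightarrow> y \<in> carrier A \<Longrightarrow> bop A m x y \<in> carrier A"
  by (auto simp: object_def Pi_iff)

lemma morI:
  assumes "f \<in> extensional (carrier A)"
    and "\<And>x. x \<in> carrier A \<Longrightarrow> f x \<in> carrier B"
    and "\<And>x y. x \<in> carrier A \<Longrightarrow> y \<in> carrier A \<Longrightarrow> f (x \<otimes>\<^bsub>A\<^esub> y) = f x \<otimes>\<^bsub>B\<^esub> f y"
    and "\<And>w x. w \<in> un \<Omega> \<Longrightarrow> x \<in> carrier A \<Longrightarrow> f (uop A w x) = uop B w (f x)"
    and "\<And>m x y. m \<in> bin \<Omega> \<Longrightarrow> x \<in> carrier A \<Longrightarrow> y \<in> carrier A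
      \<Longrightarrow> f (bop A m x y) = bop B m (f x) (f y)"
  shows "f \<in> mor \<Omega> A B"
  using assms by (auto simp: mor_def hom_def)

lemma
  assumes "f \<in> mor \<Omega> A B"
  shows mor_extensional: "f \<in> extensional (carrier A)"
    and mor_closed: "x \<in> carrier A \<Longrightarrow> f x \<in> carrier B"
    and mor_mult: "x \<in> carrier A \<Longrightarrow> y \<in> carrier A \<Longrightarrow> f (x \<otimes>\<^bsub>A\<^esub> y) = f x \<otimes>\<^bsub>B\<^esub> f y"
    and mor_uop: "w \<in> un \<Omega> \<Longrightarrow> x \<in> carrier A \<Longrightarrow> f (uop A w x) = uop B w (f x)"
    and mor_bop: "m \<in> bin \<Omega> \<Longrightarrow> x \<in> carrier A \<Longrightarrow> y \<in> carrier A
      \<Longrightarrow> f (bop A m x y) = bop B m (f x) (f y)"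
  using assms by (auto simp: mor_def hom_def)

lemma mor_group_hom:
  "object \<Omega> E A \<Longrightarrow> object \<Omega> F B \<Longrightarrow> f \<in> mor \<Omega> A B \<Longrightarrow> group_hom A B f"
  by (simp add: object_def mor_def group_hom_def group_hom_axioms_def)

lemma idm_mor: "object \<Omega> E A \<Longrightarrow> idm A \<in> mor \<Omega> A A"
  by (intro morI)
    (auto simp: idm_def object_uop_closed object_bop_closed group.is_monoid monoid.m_closed
      dest: object_group)

lemma compose_mor:
  assumes A: "object \<Omega> E A" and f: "f \<in> mor \<Omega> A B" and g: "g \<in> mor \<Omega> B C"
  shows "compose (carrier A) g f \<in> mor \<Omega> A C"
proof -
  interpret A: group A using A by (rule object_group)
  show ?thesis
    by (intro morI)
      (auto simp: compose_def object_uop_closed[OF A] object_bop_closed[OF A]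
        mor_closed[OF f] mor_mult[OF f] mor_uop[OF f] mor_bop[OF f]
        mor_closed[OF g] mor_mult[OF g] mor_uop[OF g] mor_bop[OF g])
qed

lemma compose_idm: "f \<in> mor \<Omega> A B \<Longrightarrow> compose (carrier A) f (idm A) = f"
  by (rule extensionalityI[of _ "carrier A"]) (auto simp: compose_def idm_def mor_extensional)

lemma idm_compose: "f \<in> mor \<Omega> A B \<Longrightarrow> compose (carrier A) (idm B) f = f"
  by (rule extensionalityI[of _ "carrier A"])
    (auto simp: compose_def idm_def mor_extensional mor_closed)

lemma idm_compose_idm: "compose (carrier A) (idm A) (idm A) = idm A"
  by (auto simp: compose_def idm_def)

lemma eval_closed:
  assumes A: "object \<Omega> E A" and v: "\<And>n. v n \<in> carrier A" and t: "trm_over \<Omega> t"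
  shows "eval A v t \<in> carrier A"
proof -
  interpret A: group A using A by (rule object_group)
  show ?thesis using t
    by (induction t)
      (auto simp: v trm_over_def object_uop_closed[OF A] object_bop_closed[OF A])
qed

lemma mor_eval:
  assumes A: "object \<Omega> E A" and B: "object \<Omega> F B" and f: "f \<in> mor \<Omega> A B"
    and v: "\<And>n. v n \<in> carrier A" and t: "trm_over \<Omega> t"
  shows "f (eval A v t) = eval B (\<lambda>n. f (v n)) t"
proof -
  interpret f: group_hom A B f using A B f by (rule mor_group_hom)
  have "eval A v t \<in> carrier A \<and> f (eval A v t) = eval B (\<lambda>n. f (v n)) t" using t
    by (induction t)
      (auto simp: v trm_over_def object_uop_closed[OF A] object_bop_closed[OF A]
        mor_uop[OF f] mor_bop[OF f])
  then show ?thesis ..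
qed


section \<open>Fibre products\<close>

lemma fibre_product_simps [simp]:
  "carrier (fibre_product P S d \<phi>) = {(p, s). p \<in> carrier P \<and> s \<in> carrier S \<and> d p = \<phi> s}"
  "x \<otimes>\<^bsub>fibre_product P S d \<phi>\<^esub> y = (fst x \<otimes>\<^bsub>P\<^esub> fst y, snd x \<otimes>\<^bsub>S\<^esub> snd y)"
  "\<one>\<^bsub>fibre_product P S d \<phi>\<^esub> = (\<one>\<^bsub>P\<^esub>, \<one>\<^bsub>S\<^esub>)"
  "uop (fibre_product P S d \<phi>) w x = (uop P w (fst x), uop S w (snd x))"
  "bop (fibre_product P S d \<phi>) m x y = (bop P m (fst x) (fst y), bop S m (snd x) (snd y))"
  by (simp_all add: fibre_product_def split_beta)

abbreviation fibre_fst where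
  "fibre_fst P S d \<phi> \<equiv> restrict fst (carrier (fibre_product P S d \<phi>))"

abbreviation fibre_snd where
  "fibre_snd P S d \<phi> \<equiv> restrict snd (carrier (fibre_product P S d \<phi>))"

definition fibre_pair where
  "fibre_pair T a c = (\<lambda>x\<in>carrier T. (a x, c x))"

context
  fixes \<Omega> :: "('u, 'b) signature" and E :: "('u, 'b) identity set"
    and P :: "('p, 'u, 'b) ogroup" and S :: "('s, 'u, 'b) ogroup" and R :: "('r, 'u, 'b) ogroup"
    and d :: "'p \<Rightarrow> 'r" and \<phi> :: "'s \<Rightarrow> 'r"
  assumes P: "object \<Omega> E P" and S: "object \<Omega> E S" and R: "object \<Omega> E R"
    and d: "d \<in> mor \<Omega> P R" and \<phi>: "\<phi> \<in> mor \<Omega> S R"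
begin

interpretation P: group P using P by (rule object_group)
interpretation S: group S using S by (rule object_group)
interpretation d: group_hom P R d using P R d by (rule mor_group_hom)
interpretation \<phi>: group_hom S R \<phi> using S R \<phi> by (rule mor_group_hom)

lemma fibre_product_group: "group (fibre_product P S d \<phi>)"
proof (rule groupI)
  fix x assume "x \<in> carrier (fibre_product P S d \<phi>)"
  then show "\<exists>y\<in>carrier (fibre_product P S d \<phi>).
      y \<otimes>\<^bsub>fibre_product P S d \<phi>\<^esub> x = \<one>\<^bsub>fibre_product P S d \<phi>\<^esub>"
    by (intro bexI[of _ "(inv\<^bsub>P\<^esub> fst x, inv\<^bsub>S\<^esub> snd x)"]) auto
qed (auto simp: P.m_assoc S.m_assoc)

lemma fibre_product_inv:
  assumes "x \<in> carrier (fibre_product P S d \<phi>)"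
  shows "inv\<^bsub>fibre_product P S d \<phi>\<^esub> x = (inv\<^bsub>P\<^esub> fst x, inv\<^bsub>S\<^esub> snd x)"
proof -
  interpret F: group "fibre_product P S d \<phi>" by (rule fibre_product_group)
  show ?thesis using assms by (intro F.inv_equality) auto
qed

lemma fibre_fst_mor: "fibre_fst P S d \<phi> \<in> mor \<Omega> (fibre_product P S d \<phi>) P"
  by (intro morI)
    (auto simp: object_uop_closed[OF P] object_bop_closed[OF P]
      object_uop_closed[OF S] object_bop_closed[OF S]
      mor_uop[OF d] mor_bop[OF d] mor_uop[OF \<phi>] mor_bop[OF \<phi>])

lemma fibre_snd_mor: "fibre_snd P S d \<phi> \<in> mor \<Omega> (fibre_product P S d \<phi>) S"
  by (intro morI)
    (auto simp: object_uop_closed[OF P] object_bop_closed[OF P]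
      object_uop_closed[OF S] object_bop_closed[OF S]
      mor_uop[OF d] mor_bop[OF d] mor_uop[OF \<phi>] mor_bop[OF \<phi>])

text \<open>The projections are homomorphisms and jointly injective, so an identity that holds in
  both factors holds in the fibre product.\<close>

lemma fibre_product_object:
  assumes over: "\<And>s t. (s, t) \<in> E \<Longrightarrow> trm_over \<Omega> s \<and> trm_over \<Omega> t"
  shows "object \<Omega> E (fibre_product P S d \<phi>)" (is "object \<Omega> E ?F")
proof -
  \<comment> \<open>With no identities to satisfy, \<open>object\<close> says only that the operations are closed; this
    suffices to evaluate terms in \<open>?F\<close>.\<close>
  have F: "object \<Omega> {} ?F"
    using fibre_product_group
    by (auto simp: object_def[of \<Omega> "{}"] object_uop_closed[OF P] object_bop_closed[OF P]
        object_uop_closed[OF S] object_bop_closed[OF S]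
        mor_uop[OF d] mor_bop[OF d] mor_uop[OF \<phi>] mor_bop[OF \<phi>])
  have "satisfies ?F (l, r)" if lr: "(l, r) \<in> E" for l r
    unfolding satisfies_def
  proof (intro allI impI)
    fix v :: "nat \<Rightarrow> 'p \<times> 's" assume "\<forall>n. v n \<in> carrier ?F"
    then have v: "v n \<in> carrier ?F" for n by blast
    have eq: "f (eval ?F v l) = f (eval ?F v r)"
      if f: "f \<in> mor \<Omega> ?F A" and A: "object \<Omega> E A" for f and A :: "('x, 'u, 'b) ogroup"
    proof -
      have "satisfies A (l, r)" using A lr by (auto simp: object_def)
      then show ?thesis
        using over[OF lr] mor_closed[OF f v]
        by (auto simp: mor_eval[OF F A f v] satisfies_def simp del: fibre_product_simps)
    qed
    have "eval ?F v l \<in> carrier ?F" "eval ?F v r \<in> carrier ?F"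
      using over[OF lr] v by (auto intro: eval_closed[OF F] simp del: fibre_product_simps)
    then show "eval ?F v (fst (l, r)) = eval ?F v (snd (l, r))"
      using eq[OF fibre_fst_mor P] eq[OF fibre_snd_mor S]
      by (auto simp: prod_eq_iff simp del: fibre_product_simps)
  qed
  then show ?thesis using F by (auto simp: object_def)
qed

lemma fibre_pair_mor:
  assumes a: "a \<in> mor \<Omega> T P" and c: "c \<in> mor \<Omega> T S" and T: "object \<Omega> E T"
    and eq: "\<And>x. x \<in> carrier T \<Longrightarrow> d (a x) = \<phi> (c x)"
  shows "fibre_pair T a c \<in> mor \<Omega> T (fibre_product P S d \<phi>)"
proof -
  interpret T: group T using T by (rule object_group)
  show ?thesis
    by (intro morI)
      (auto simp: fibre_pair_def object_uop_closed[OF T] object_bop_closed[OF T] eq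
        mor_closed[OF a] mor_mult[OF a] mor_uop[OF a] mor_bop[OF a]
        mor_closed[OF c] mor_mult[OF c] mor_uop[OF c] mor_bop[OF c])
qed

theorem fibre_product_pullback_square:
  assumes over: "\<And>s t. (s, t) \<in> E \<Longrightarrow> trm_over \<Omega> s \<and> trm_over \<Omega> t"
  shows "pullback_square TYPE('t) \<Omega> E (fibre_product P S d \<phi>) P S R
    (fibre_fst P S d \<phi>) (fibre_snd P S d \<phi>) d \<phi>"
    (is "pullback_square _ \<Omega> E ?F P S R ?f ?g d \<phi>")
  unfolding pullback_square_def
proof (intro conjI allI impI fibre_product_object[OF over] P S R d \<phi> fibre_fst_mor fibre_snd_mor)
  show "compose (carrier ?F) d ?f = compose (carrier ?F) \<phi> ?g"
    by (auto simp: compose_def fun_eq_iff)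
next
  fix T :: "('t, 'u, 'b) ogroup" and a c
  assume "object \<Omega> E T \<and> a \<in> mor \<Omega> T P \<and> c \<in> mor \<Omega> T S \<and>
    compose (carrier T) d a = compose (carrier T) \<phi> c"
  then have T: "object \<Omega> E T" and a: "a \<in> mor \<Omega> T P" and c: "c \<in> mor \<Omega> T S"
    and eq: "compose (carrier T) d a = compose (carrier T) \<phi> c" by auto
  have eq': "d (a x) = \<phi> (c x)" if "x \<in> carrier T" for x
    using fun_cong[OF eq, of x] that by (simp add: compose_def)
  show "\<exists>!h. h \<in> mor \<Omega> T ?F \<and> compose (carrier T) ?f h = a \<and> compose (carrier T) ?g h = c"
  proof (intro ex1I[of _ "fibre_pair T a c"] conjI)
    show "fibre_pair T a c \<in> mor \<Omega> T ?F" by (intro fibre_pair_mor a c T eq')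
    show "compose (carrier T) ?f (fibre_pair T a c) = a"
      by (rule extensionalityI[of _ "carrier T"])
        (auto simp: compose_def fibre_pair_def eq' mor_closed[OF a] mor_closed[OF c]
          mor_extensional[OF a])
    show "compose (carrier T) ?g (fibre_pair T a c) = c"
      by (rule extensionalityI[of _ "carrier T"])
        (auto simp: compose_def fibre_pair_def eq' mor_closed[OF a] mor_closed[OF c]
          mor_extensional[OF c])
  next
    fix h assume h: "h \<in> mor \<Omega> T ?F \<and> compose (carrier T) ?f h = a \<and> compose (carrier T) ?g h = c"
    then have hm: "h \<in> mor \<Omega> T ?F" by blast
    show "h = fibre_pair T a c"
    proof (rule extensionalityI[of _ "carrier T"])
      show "h \<in> extensional (carrier T)" by (rule mor_extensional[OF hm])
      show "fibre_pair T a c \<in> extensional (carrier T)" by (simp add: fibre_pair_def)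
      fix x assume x: "x \<in> carrier T"
      have "a x = compose (carrier T) ?f h x" "c x = compose (carrier T) ?g h x"
        using h by auto
      then show "h x = fibre_pair T a c x"
        using x mor_closed[OF hm x] by (auto simp: compose_def fibre_pair_def)
    qed
  qed
qed

end


section \<open>Morphisms out of a split extension\<close>

context modified_category_of_interest
begin

text \<open>
  The axioms of the locale assert validity over one fixed carrier type; \<open>valid_imp_satisfies\<close>
  makes them available in objects over any type, such as the ones built from pairs below.
\<close>

lemma bop_distrib_right:
  assumes A: "object \<Omega> E A" and m: "m \<in> bin \<Omega>"
    and xyz: "x \<in> carrier A" "y \<in> carrier A" "z \<in> carrier A"
  shows "bop A m x (y \<otimes>\<^bsub>A\<^esub> z) = bop A m x y \<otimes>\<^bsub>A\<^esub> bop A m x z"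
proof -
  have "satisfies A (BOp m (Var 1) (Add (Var 2) (Var 3)),
      Add (BOp m (Var 1) (Var 2)) (BOp m (Var 1) (Var 3)))"
    by (rule valid_imp_satisfies[OF identities_over _ _ bin_distrib[OF m] A])
      (use m in \<open>auto simp: trm_over_def\<close>)
  from this[unfolded satisfies_def, rule_format, of "\<lambda>n. if n = 1 then x else if n = 2 then y else z"]
  show ?thesis using xyz by simp
qed

text \<open>
  The opposite of an operation is provided as an identity and not inside one object, because
  \<open>split_extension_extend\<close> needs the same opposite in two objects with different carrier types.
\<close>

lemma opposite_bop:
  assumes m: "m \<in> bin \<Omega>"
  obtains m' where "m' \<in> bin \<Omega>"
    and "valid \<Omega> E (BOp m' (Var 1) (Var 2), BOp m (Var 2) (Var 1))"
  using opposite[OF m] by blast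

lemma bop_opposite:
  assumes A: "object \<Omega> E A" and m: "m \<in> bin \<Omega>" "m' \<in> bin \<Omega>"
    and v: "valid \<Omega> E (BOp m' (Var 1) (Var 2), BOp m (Var 2) (Var 1))"
    and xy: "x \<in> carrier A" "y \<in> carrier A"
  shows "bop A m' x y = bop A m y x"
proof -
  have "satisfies A (BOp m' (Var 1) (Var 2), BOp m (Var 2) (Var 1))"
    by (rule valid_imp_satisfies[OF identities_over _ _ v A])
      (use m in \<open>auto simp: trm_over_def\<close>)
  from this[unfolded satisfies_def, rule_format, of "\<lambda>n. if n = 1 then x else y"]
  show ?thesis using xy by simp
qed

lemma bop_distrib_left:
  assumes A: "object \<Omega> E A" and m: "m \<in> bin \<Omega>"
    and xyz: "x \<in> carrier A" "y \<in> carrier A" "z \<in> carrier A"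
  shows "bop A m (x \<otimes>\<^bsub>A\<^esub> y) z = bop A m x z \<otimes>\<^bsub>A\<^esub> bop A m y z"
proof -
  interpret A: group A using A by (rule object_group)
  obtain m' where m': "m' \<in> bin \<Omega>"
    and v: "valid \<Omega> E (BOp m' (Var 1) (Var 2), BOp m (Var 2) (Var 1))"
    by (rule opposite_bop[OF m])
  show ?thesis
    using bop_distrib_right[OF A m', of z x y] xyz by (simp add: bop_opposite[OF A m m' v])
qed

lemma bop_mult_mult:
  assumes A: "object \<Omega> E A" and m: "m \<in> bin \<Omega>"
    and "x \<in> carrier A" "y \<in> carrier A" "x' \<in> carrier A" "y' \<in> carrier A"
  shows "bop A m (x \<otimes>\<^bsub>A\<^esub> y) (x' \<otimes>\<^bsub>A\<^esub> y') =
    (bop A m x x' \<otimes>\<^bsub>A\<^esub> bop A m y x') \<otimes>\<^bsub>A\<^esub> (bop A m x y' \<otimes>\<^bsub>A\<^esub> bop A m y y')"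
proof -
  interpret A: group A using A by (rule object_group)
  show ?thesis using assms by (simp add: bop_distrib_right bop_distrib_left)
qed

lemma uop_mult:
  assumes A: "object \<Omega> E A" and w: "w \<in> un \<Omega>" and xy: "x \<in> carrier A" "y \<in> carrier A"
  shows "uop A w (x \<otimes>\<^bsub>A\<^esub> y) = uop A w x \<otimes>\<^bsub>A\<^esub> uop A w y"
proof -
  have "satisfies A (UOp w (Add (Var 1) (Var 2)), Add (UOp w (Var 1)) (UOp w (Var 2)))"
    by (rule valid_imp_satisfies[OF identities_over _ _ un_additive[OF w] A])
      (use w in \<open>auto simp: trm_over_def\<close>)
  from this[unfolded satisfies_def, rule_format, of "\<lambda>n. if n = 1 then x else y"]
  show ?thesis using xy by simp
qed

lemma uop_one:
  assumes A: "object \<Omega> E A" and w: "w \<in> un \<Omega>"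
  shows "uop A w \<one>\<^bsub>A\<^esub> = \<one>\<^bsub>A\<^esub>"
proof -
  interpret A: group A using A by (rule object_group)
  show ?thesis
    using uop_mult[OF A w A.one_closed A.one_closed] object_uop_closed[OF A w A.one_closed] by simp
qed

lemma bop_one_right:
  assumes A: "object \<Omega> E A" and m: "m \<in> bin \<Omega>" and x: "x \<in> carrier A"
  shows "bop A m x \<one>\<^bsub>A\<^esub> = \<one>\<^bsub>A\<^esub>"
proof -
  interpret A: group A using A by (rule object_group)
  show ?thesis
    using bop_distrib_right[OF A m x A.one_closed A.one_closed]
      object_bop_closed[OF A m x A.one_closed] by simp
qed

lemma trivial_mor:
  assumes A: "object \<Omega> E A" and B: "object \<Omega> E B"
  shows "(\<lambda>x\<in>carrier A. \<one>\<^bsub>B\<^esub>) \<in> mor \<Omega> A B"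
proof -
  interpret A: group A using A by (rule object_group)
  interpret B: group B using B by (rule object_group)
  show ?thesis
    by (intro morI)
      (auto simp: object_uop_closed[OF A] object_bop_closed[OF A] uop_one[OF B] bop_one_right[OF B])
qed


text \<open>
  Every element of \<open>X\<close> is uniquely \<open>i a \<otimes> s b\<close>, which forces \<open>h (i a \<otimes> s b) = f a \<otimes> g b\<close>. This
  is multiplicative because \<open>f\<close> respects conjugation. It commutes with the unary operations
  because these are additive. Expanding a binary operation on two such elements by
  distributivity leaves four products; those of \<open>i a\<close> with \<open>i a'\<close> and of \<open>s b\<close> with \<open>s b'\<close> are
  preserved because \<open>f\<close> and \<open>g\<close> are morphisms, the mixed ones because \<open>f\<close> respects the action.
\<close>

lemma split_extension_extend:
  fixes act star
  assumes se: "split_extension \<Omega> E A X B i p s"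
    and ia: "induced_action \<Omega> A X B i s act star"
    and C: "object \<Omega> E C" and f: "f \<in> mor \<Omega> A C" and g: "g \<in> mor \<Omega> B C"
    and f_act: "\<And>b a. b \<in> carrier B \<Longrightarrow> a \<in> carrier A
      \<Longrightarrow> f (act b a) = g b \<otimes>\<^bsub>C\<^esub> f a \<otimes>\<^bsub>C\<^esub> inv\<^bsub>C\<^esub> (g b)"
    and f_star: "\<And>m b a. m \<in> bin \<Omega> \<Longrightarrow> b \<in> carrier B \<Longrightarrow> a \<in> carrier A
      \<Longrightarrow> f (star m b a) = bop C m (g b) (f a)"
  obtains h where "h \<in> mor \<Omega> X C"
    and "\<And>a. a \<in> carrier A \<Longrightarrow> h (i a) = f a" and "\<And>b. b \<in> carrier B \<Longrightarrow> h (s b) = g b"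
proof -
  have A: "object \<Omega> E A" and X: "object \<Omega> E X" and B: "object \<Omega> E B"
    and i: "i \<in> mor \<Omega> A X" and p: "p \<in> mor \<Omega> X B" and s: "s \<in> mor \<Omega> B X"
    and inj: "inj_on i (carrier A)" and ker: "i ` carrier A = kernel X B p"
    and ps: "\<And>b. b \<in> carrier B \<Longrightarrow> p (s b) = b"
    using se by (auto simp: split_extension_def)
  have act: "act b a \<in> carrier A" "i (act b a) = s b \<otimes>\<^bsub>X\<^esub> i a \<otimes>\<^bsub>X\<^esub> inv\<^bsub>X\<^esub> (s b)"
    if "b \<in> carrier B" "a \<in> carrier A" for b a
    using ia that by (auto simp: induced_action_def)
  have star: "star m b a \<in> carrier A" "i (star m b a) = bop X m (s b) (i a)"
    if "m \<in> bin \<Omega>" "b \<in> carrier B" "a \<in> carrier A" for m b a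
    using ia that by (auto simp: induced_action_def)
  interpret i: group_hom A X i using A X i by (rule mor_group_hom)
  interpret p: group_hom X B p using X B p by (rule mor_group_hom)
  interpret s: group_hom B X s using B X s by (rule mor_group_hom)
  interpret f: group_hom A C f using A C f by (rule mor_group_hom)
  interpret g: group_hom B C g using B C g by (rule mor_group_hom)
  have pi: "p (i a) = \<one>\<^bsub>B\<^esub>" if "a \<in> carrier A" for a
    using ker that by (auto simp: kernel_def)
  have decompose: "\<exists>a\<in>carrier A. \<exists>b\<in>carrier B. x = i a \<otimes>\<^bsub>X\<^esub> s b" if x: "x \<in> carrier X" for x
  proof -
    have "x \<otimes>\<^bsub>X\<^esub> inv\<^bsub>X\<^esub> (s (p x)) \<in> i ` carrier A"
      using x by (simp add: ker kernel_def ps)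
    then obtain a where "a \<in> carrier A" "i a = x \<otimes>\<^bsub>X\<^esub> inv\<^bsub>X\<^esub> (s (p x))" by force
    moreover from this have "x = i a \<otimes>\<^bsub>X\<^esub> s (p x)" using x by (simp add: i.H.m_assoc)
    ultimately show ?thesis using x p.hom_closed by blast
  qed
  define h where
    "h = (\<lambda>x\<in>carrier X. f (inv_into (carrier A) i (x \<otimes>\<^bsub>X\<^esub> inv\<^bsub>X\<^esub> (s (p x)))) \<otimes>\<^bsub>C\<^esub> g (p x))"
  have h: "h (i a \<otimes>\<^bsub>X\<^esub> s b) = f a \<otimes>\<^bsub>C\<^esub> g b" if "a \<in> carrier A" "b \<in> carrier B" for a b
    using that by (simp add: h_def pi ps i.H.m_assoc inv_into_f_f[OF inj])
  have hi: "h (i a) = f a" if "a \<in> carrier A" for a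
    using h[OF that, of "\<one>\<^bsub>B\<^esub>"] that by simp
  have hs: "h (s b) = g b" if "b \<in> carrier B" for b
    using h[OF _ that, of "\<one>\<^bsub>A\<^esub>"] that by simp
  have h_closed: "h x \<in> carrier C" if "x \<in> carrier X" for x
    using decompose[OF that] by (auto simp: h)
  have h_mult: "h (x \<otimes>\<^bsub>X\<^esub> y) = h x \<otimes>\<^bsub>C\<^esub> h y" if xy: "x \<in> carrier X" "y \<in> carrier X" for x y
  proof -
    obtain a b a' b' where ab: "a \<in> carrier A" "b \<in> carrier B" "a' \<in> carrier A" "b' \<in> carrier B"
      and x: "x = i a \<otimes>\<^bsub>X\<^esub> s b" and y: "y = i a' \<otimes>\<^bsub>X\<^esub> s b'"
      using decompose xy by meson
    have "x \<otimes>\<^bsub>X\<^esub> y = i (a \<otimes>\<^bsub>A\<^esub> act b a') \<otimes>\<^bsub>X\<^esub> s (b \<otimes>\<^bsub>B\<^esub> b')"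
      using ab by (simp add: x y act i.H.m_assoc i.H.inv_solve_left)
    then have "h (x \<otimes>\<^bsub>X\<^esub> y) = f (a \<otimes>\<^bsub>A\<^esub> act b a') \<otimes>\<^bsub>C\<^esub> g (b \<otimes>\<^bsub>B\<^esub> b')"
      using ab by (simp only: h act i.G.m_closed p.H.m_closed)
    also have "\<dots> = h x \<otimes>\<^bsub>C\<^esub> h y"
      using ab by (simp add: x y h act f_act f.H.m_assoc f.H.inv_solve_left')
    finally show ?thesis .
  qed
  have h_uop: "h (uop X w x) = uop C w (h x)" if w: "w \<in> un \<Omega>" and x: "x \<in> carrier X" for w x
  proof -
    obtain a b where ab: "a \<in> carrier A" "b \<in> carrier B" and x: "x = i a \<otimes>\<^bsub>X\<^esub> s b"
      using decompose x by meson
    have "uop X w x = i (uop A w a) \<otimes>\<^bsub>X\<^esub> s (uop B w b)"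
      using ab by (simp add: x uop_mult[OF X w] mor_uop[OF i w] mor_uop[OF s w])
    then show ?thesis
      using ab w by (simp add: x h object_uop_closed[OF A] object_uop_closed[OF B]
          uop_mult[OF C w] mor_uop[OF f w] mor_uop[OF g w])
  qed
  have h_bop: "h (bop X m x y) = bop C m (h x) (h y)"
    if m: "m \<in> bin \<Omega>" and xy: "x \<in> carrier X" "y \<in> carrier X" for m x y
  proof -
    obtain a b a' b' where ab: "a \<in> carrier A" "b \<in> carrier B" "a' \<in> carrier A" "b' \<in> carrier B"
      and x: "x = i a \<otimes>\<^bsub>X\<^esub> s b" and y: "y = i a' \<otimes>\<^bsub>X\<^esub> s b'"
      using decompose xy by meson
    obtain m' where m': "m' \<in> bin \<Omega>"
      and v: "valid \<Omega> E (BOp m' (Var 1) (Var 2), BOp m (Var 2) (Var 1))"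
      by (rule opposite_bop[OF m])
    have aa: "h (bop X m (i a) (i a')) = bop C m (f a) (f a')"
      using ab m by (simp flip: mor_bop[OF i m] mor_bop[OF f m] add: hi object_bop_closed[OF A])
    have bb: "h (bop X m (s b) (s b')) = bop C m (g b) (g b')"
      using ab m by (simp flip: mor_bop[OF s m] mor_bop[OF g m] add: hs object_bop_closed[OF B])
    have ba: "h (bop X m (s b) (i a')) = bop C m (g b) (f a')"
      using ab m by (simp flip: star(2) add: hi star(1) f_star)
    \<comment> \<open>The action only prescribes products with the element of \<open>B\<close> on the left; this mixed
      product has it on the right and is turned round by the opposite operation.\<close>
    have "h (bop X m (i a) (s b')) = h (bop X m' (s b') (i a))"
      using ab by (simp add: bop_opposite[OF X m m' v])
    also have "\<dots> = bop C m' (g b') (f a)"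
      using ab m' by (simp flip: star(2) add: hi star(1) f_star)
    also have "\<dots> = bop C m (f a) (g b')"
      using ab by (simp add: bop_opposite[OF C m m' v])
    finally have ab': "h (bop X m (i a) (s b')) = bop C m (f a) (g b')" .
    show ?thesis
      using ab m by (simp add: x y hi hs h_mult object_bop_closed[OF X] bop_mult_mult[OF X m]
          bop_mult_mult[OF C m] aa bb ba ab')
  qed
  have "h \<in> mor \<Omega> X C"
    by (intro morI h_closed h_mult h_uop h_bop) (simp add: h_def)
  then show thesis by (rule that[OF _ hi hs])
qed

end


section \<open>Crossed modules over a fixed object\<close>

lemma
  assumes "crossed_module \<Omega> E M"
  shows crossed_module_dom: "object \<Omega> E (dom M)"
    and crossed_module_cod: "object \<Omega> E (cod M)"
    and crossed_module_bd: "bd M \<in> mor \<Omega> (dom M) (cod M)"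
    and crossed_module_action: "derived_action \<Omega> E (dom M) (cod M) (act M) (star M)"
    and crossed_module_bd_act: "r \<in> carrier (cod M) \<Longrightarrow> c \<in> carrier (dom M) \<Longrightarrow>
      bd M (act M r c) = r \<otimes>\<^bsub>cod M\<^esub> bd M c \<otimes>\<^bsub>cod M\<^esub> inv\<^bsub>cod M\<^esub> r"
    and crossed_module_bd_star: "m \<in> bin \<Omega> \<Longrightarrow> r \<in> carrier (cod M) \<Longrightarrow> c \<in> carrier (dom M) \<Longrightarrow>
      bd M (star M m r c) = bop (cod M) m r (bd M c)"
    and crossed_module_peiffer_act: "c \<in> carrier (dom M) \<Longrightarrow> c' \<in> carrier (dom M) \<Longrightarrow>
      act M (bd M c) c' = c \<otimes>\<^bsub>dom M\<^esub> c' \<otimes>\<^bsub>dom M\<^esub> inv\<^bsub>dom M\<^esub> c"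
    and crossed_module_peiffer_star: "m \<in> bin \<Omega> \<Longrightarrow> c \<in> carrier (dom M) \<Longrightarrow> c' \<in> carrier (dom M) \<Longrightarrow>
      star M m (bd M c) c' = bop (dom M) m c c'"
  using assms unfolding crossed_module_def by blast+

lemma
  assumes "derived_action \<Omega> E A B ac st" and "b \<in> carrier B" and "a \<in> carrier A"
  shows derived_action_act_closed: "ac b a \<in> carrier A"
    and derived_action_star_closed: "m \<in> bin \<Omega> \<Longrightarrow> st m b a \<in> carrier A"
  using assms unfolding derived_action_def induced_action_def by blast+

lemma idm_xmod_mor:
  assumes "crossed_module \<Omega> E M"
  shows "(idm (dom M), idm (cod M)) \<in> xmod_mor \<Omega> M M"
proof -
  note der = crossed_module_action[OF assms]
  show ?thesis
    using idm_mor[OF crossed_module_dom[OF assms]] idm_mor[OF crossed_module_cod[OF assms]]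
      mor_closed[OF crossed_module_bd[OF assms]]
      derived_action_act_closed[OF der] derived_action_star_closed[OF der]
    by (simp add: xmod_mor_def) (simp add: idm_def)
qed

lemma compose_xmod_mor:
  assumes M: "crossed_module \<Omega> E M" and f: "(f, g) \<in> xmod_mor \<Omega> M N" and f': "(f', g') \<in> xmod_mor \<Omega> N L"
  shows "(compose (carrier (dom M)) f' f, compose (carrier (cod M)) g' g) \<in> xmod_mor \<Omega> M L"
proof -
  note P = crossed_module_dom[OF M] and R = crossed_module_cod[OF M] and d = crossed_module_bd[OF M]
  note closed = derived_action_act_closed[OF crossed_module_action[OF M]]
    derived_action_star_closed[OF crossed_module_action[OF M]]
  have fm: "f \<in> mor \<Omega> (dom M) (dom N)" "g \<in> mor \<Omega> (cod M) (cod N)"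
    "f' \<in> mor \<Omega> (dom N) (dom L)" "g' \<in> mor \<Omega> (cod N) (cod L)"
    using f f' by (auto simp: xmod_mor_def)
  then show ?thesis
    using f f' closed
    by (auto simp: xmod_mor_def compose_mor[OF P] compose_mor[OF R] mor_closed[OF d])
      (auto simp: compose_def mor_closed[OF d] mor_closed[OF fm(1)] mor_closed[OF fm(2)])
qed

lemma XMod_over_simps [simp]:
  "M \<in> Ob (XMod_over \<Omega> E R) \<longleftrightarrow> crossed_module \<Omega> E M \<and> cod M = R"
  "F \<in> Hom (XMod_over \<Omega> E R) M N \<longleftrightarrow> F \<in> xmod_mor \<Omega> M N \<and> snd F = idm R"
  "Id (XMod_over \<Omega> E R) M = (idm (dom M), idm R)"
  "Comp (XMod_over \<Omega> E R) M N L G F =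
    (compose (carrier (dom M)) (fst G) (fst F), compose (carrier R) (snd G) (snd F))"
  by (auto simp: XMod_over_def split_beta)

lemma XMod_over_category:
  fixes R :: "('r, 'u, 'b) ogroup"
  shows "is_category (XMod_over \<Omega> E R :: (('p, 'r, 'u, 'b) xmod, _) category)"
  unfolding is_category_def
proof (intro conjI ballI)
  fix M :: "('p, 'r, 'u, 'b) xmod" assume "M \<in> Ob (XMod_over \<Omega> E R)"
  then show "Id (XMod_over \<Omega> E R) M \<in> Hom (XMod_over \<Omega> E R) M M"
    using idm_xmod_mor[of \<Omega> E M] by auto
next
  fix M N L :: "('p, 'r, 'u, 'b) xmod" and F G
  assume "M \<in> Ob (XMod_over \<Omega> E R)"
    and "F \<in> Hom (XMod_over \<Omega> E R) M N" "G \<in> Hom (XMod_over \<Omega> E R) N L"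
  then show "Comp (XMod_over \<Omega> E R) M N L G F \<in> Hom (XMod_over \<Omega> E R) M L"
    using compose_xmod_mor[of \<Omega> E M "fst F" "snd F" N "fst G" "snd G" L]
    by (cases F; cases G) (auto simp: idm_compose_idm)
next
  fix M N :: "('p, 'r, 'u, 'b) xmod" and F
  assume F: "F \<in> Hom (XMod_over \<Omega> E R) M N"
  then have "fst F \<in> mor \<Omega> (dom M) (dom N)" by (auto simp: xmod_mor_def)
  with F show "Comp (XMod_over \<Omega> E R) M M N F (Id (XMod_over \<Omega> E R) M) = F"
    and "Comp (XMod_over \<Omega> E R) M N N (Id (XMod_over \<Omega> E R) N) F = F"
    by (auto simp: prod_eq_iff compose_idm idm_compose idm_compose_idm)
next
  fix M N L K :: "('p, 'r, 'u, 'b) xmod" and F G H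
  assume "F \<in> Hom (XMod_over \<Omega> E R) M N" "G \<in> Hom (XMod_over \<Omega> E R) N L"
    and "H \<in> Hom (XMod_over \<Omega> E R) L K"
  then have "fst F \<in> carrier (dom M) \<rightarrow> carrier (dom N)" "snd F = idm R" "snd G = idm R" "snd H = idm R"
    by (auto simp: xmod_mor_def mor_closed)
  then show "Comp (XMod_over \<Omega> E R) M N K (Comp (XMod_over \<Omega> E R) N L K H G) F =
      Comp (XMod_over \<Omega> E R) M L K H (Comp (XMod_over \<Omega> E R) M N L G F)"
    by (simp add: idm_compose_idm compose_assoc)
qed


section \<open>The pullback crossed module\<close>

context modified_category_of_interest
begin

text \<open>
  A split extension for the pullback action is cut out of \<open>X \<times> S \<times> S\<close>, where \<open>X\<close> is one for the
  action of \<open>R\<close> on \<open>P\<close>. The middle factor \<open>t\<close> lies over \<open>\<pi> x\<close> and is the projection to the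
  base; the last one \<open>u\<close> lies over \<open>\<tau> x\<close> and becomes the second component of \<open>P \<times>\<^sub>R S\<close> on the
  kernel. Conjugating by \<open>(\<sigma> (\<phi> t), t, t)\<close> then acts on \<open>u\<close> by conjugation with \<open>t\<close> in \<open>S\<close>, which
  is the second component of the pullback action.
\<close>

lemma pullback_derived_action:
  fixes M :: "('p, 'r, 'u, 'b) xmod"
  assumes M: "crossed_module \<Omega> E M" and S: "object \<Omega> E S" and \<phi>: "\<phi> \<in> mor \<Omega> S (cod M)"
  shows "derived_action \<Omega> E (dom (pullback_xmod S \<phi> M)) S
    (act (pullback_xmod S \<phi> M)) (star (pullback_xmod S \<phi> M))"
proof -
  let ?R = "cod M" and ?P = "dom M" and ?d = "bd M"
  define Q where "Q = fibre_product ?P S ?d \<phi>"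
  note P = crossed_module_dom[OF M] and R = crossed_module_cod[OF M] and d = crossed_module_bd[OF M]
    and d_act = crossed_module_bd_act[OF M] and d_star = crossed_module_bd_star[OF M]
    and der = crossed_module_action[OF M]
  interpret \<phi>: group_hom S ?R \<phi> using S R \<phi> by (rule mor_group_hom)
  obtain X :: "('p \<times> 'r, 'u, 'b) ogroup" and i \<pi> \<sigma>
    where se: "split_extension \<Omega> E ?P X ?R i \<pi> \<sigma>"
      and ia: "induced_action \<Omega> ?P X ?R i \<sigma> (act M) (star M)"
    using der unfolding derived_action_def by blast
  have X: "object \<Omega> E X"
    and i: "i \<in> mor \<Omega> ?P X" and \<pi>: "\<pi> \<in> mor \<Omega> X ?R" and \<sigma>: "\<sigma> \<in> mor \<Omega> ?R X"
    and inj: "inj_on i (carrier ?P)" and ker: "i ` carrier ?P = kernel X ?R \<pi>"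
    and \<pi>\<sigma>: "\<And>b. b \<in> carrier ?R \<Longrightarrow> \<pi> (\<sigma> b) = b"
    using se by (auto simp: split_extension_def)
  interpret i: group_hom ?P X i using P X i by (rule mor_group_hom)
  interpret \<sigma>: group_hom ?R X \<sigma> using R X \<sigma> by (rule mor_group_hom)
  have \<pi>i: "\<pi> (i c) = \<one>\<^bsub>?R\<^esub>" if "c \<in> carrier ?P" for c
    using ker that by (auto simp: kernel_def)
  obtain \<tau> where \<tau>: "\<tau> \<in> mor \<Omega> X ?R"
    and \<tau>i: "\<And>c. c \<in> carrier ?P \<Longrightarrow> \<tau> (i c) = ?d c"
    and \<tau>\<sigma>: "\<And>r. r \<in> carrier ?R \<Longrightarrow> \<tau> (\<sigma> r) = r"
  proof (rule split_extension_extend[OF se ia R d idm_mor[OF R]])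
    show "?d (act M r c) = idm ?R r \<otimes>\<^bsub>?R\<^esub> ?d c \<otimes>\<^bsub>?R\<^esub> inv\<^bsub>?R\<^esub> (idm ?R r)"
      if "r \<in> carrier ?R" "c \<in> carrier ?P" for r c
      using that by (simp add: idm_def d_act)
    show "?d (star M m r c) = bop ?R m (idm ?R r) (?d c)"
      if "m \<in> bin \<Omega>" "r \<in> carrier ?R" "c \<in> carrier ?P" for m r c
      using that by (simp add: idm_def d_star)
  qed (auto simp: idm_def)
  define Y where "Y = fibre_product X S \<pi> \<phi>"
  define \<tau>' where "\<tau>' = compose (carrier Y) \<tau> (fibre_fst X S \<pi> \<phi>)"
  define Z where "Z = fibre_product Y S \<tau>' \<phi>"
  define p where "p = compose (carrier Z) (fibre_snd X S \<pi> \<phi>) (fibre_fst Y S \<tau>' \<phi>)"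
  define s where "s = fibre_pair S (fibre_pair S (compose (carrier S) \<sigma> \<phi>) (idm S)) (idm S)"
  define j where "j = fibre_pair Q
    (fibre_pair Q (compose (carrier Q) i (fibre_fst ?P S ?d \<phi>)) (\<lambda>q\<in>carrier Q. \<one>\<^bsub>S\<^esub>))
    (fibre_snd ?P S ?d \<phi>)"
  note over = identities_over
  have Q: "object \<Omega> E Q"
    unfolding Q_def by (rule fibre_product_object[OF P S R d \<phi> over])
  have Y: "object \<Omega> E Y"
    unfolding Y_def by (rule fibre_product_object[OF X S R \<pi> \<phi> over])
  have \<tau>': "\<tau>' \<in> mor \<Omega> Y ?R"
    unfolding \<tau>'_def
    by (rule compose_mor[OF Y _ \<tau>]) (unfold Y_def, rule fibre_fst_mor[OF X S R \<pi> \<phi>])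
  have Z: "object \<Omega> E Z"
    unfolding Z_def by (rule fibre_product_object[OF Y S R \<tau>' \<phi> over])
  have Qc: "carrier Q = {(c, u). c \<in> carrier ?P \<and> u \<in> carrier S \<and> ?d c = \<phi> u}"
    by (simp add: Q_def)
  have Zc: "carrier Z = {((x, t), u). x \<in> carrier X \<and> t \<in> carrier S \<and> u \<in> carrier S \<and>
      \<pi> x = \<phi> t \<and> \<tau> x = \<phi> u}"
    by (auto simp: Z_def Y_def \<tau>'_def compose_def)
  have p_eq: "p ((x, t), u) = t" if "((x, t), u) \<in> carrier Z" for x t u
    using that by (auto simp: p_def compose_def Z_def Y_def)
  have s_eq: "s t = ((\<sigma> (\<phi> t), t), t)" if "t \<in> carrier S" for t
    using that by (auto simp: s_def fibre_pair_def compose_def idm_def)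
  have j_eq: "j (c, u) = ((i c, \<one>\<^bsub>S\<^esub>), u)" if "(c, u) \<in> carrier Q" for c u
    using that by (auto simp: j_def fibre_pair_def compose_def Q_def)
  have p: "p \<in> mor \<Omega> Z S"
    unfolding p_def
  proof (rule compose_mor[OF Z])
    show "fibre_fst Y S \<tau>' \<phi> \<in> mor \<Omega> Z Y"
      unfolding Z_def by (rule fibre_fst_mor[OF Y S R \<tau>' \<phi>])
    show "fibre_snd X S \<pi> \<phi> \<in> mor \<Omega> Y S"
      unfolding Y_def by (rule fibre_snd_mor[OF X S R \<pi> \<phi>])
  qed
  have s: "s \<in> mor \<Omega> S Z"
    unfolding s_def Z_def
  proof (rule fibre_pair_mor[OF Y S R \<tau>' \<phi> _ idm_mor[OF S] S])
    show "fibre_pair S (compose (carrier S) \<sigma> \<phi>) (idm S) \<in> mor \<Omega> S Y"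
      unfolding Y_def
      by (rule fibre_pair_mor[OF X S R \<pi> \<phi> compose_mor[OF S \<phi> \<sigma>] idm_mor[OF S] S])
        (simp add: compose_def idm_def \<pi>\<sigma>)
  qed (simp add: \<tau>'_def compose_def fibre_pair_def idm_def Y_def \<pi>\<sigma> \<tau>\<sigma>)
  have j: "j \<in> mor \<Omega> Q Z"
    unfolding j_def Z_def
  proof (rule fibre_pair_mor[OF Y S R \<tau>' \<phi> _ _ Q])
    show "fibre_snd ?P S ?d \<phi> \<in> mor \<Omega> Q S"
      unfolding Q_def by (rule fibre_snd_mor[OF P S R d \<phi>])
    have "fibre_fst ?P S ?d \<phi> \<in> mor \<Omega> Q ?P"
      unfolding Q_def by (rule fibre_fst_mor[OF P S R d \<phi>])
    then have "compose (carrier Q) i (fibre_fst ?P S ?d \<phi>) \<in> mor \<Omega> Q X"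
      by (rule compose_mor[OF Q _ i])
    then show "fibre_pair Q (compose (carrier Q) i (fibre_fst ?P S ?d \<phi>))
        (\<lambda>q\<in>carrier Q. \<one>\<^bsub>S\<^esub>) \<in> mor \<Omega> Q Y"
      unfolding Y_def
      by (rule fibre_pair_mor[OF X S R \<pi> \<phi> _ trivial_mor[OF Q S] Q])
        (auto simp: compose_def Q_def \<pi>i)
  qed (auto simp: \<tau>'_def compose_def fibre_pair_def Q_def Y_def \<pi>i \<tau>i)
  have "split_extension \<Omega> E Q Z S j p s"
    unfolding split_extension_def
  proof (intro conjI Q Z S j p s ballI)
    show ps: "p (s t) = t" if "t \<in> carrier S" for t
      using mor_closed[OF s that] that by (simp add: s_eq p_eq)
    show "p ` carrier Z = carrier S"
      using mor_closed[OF p] mor_closed[OF s] ps by (force simp: image_iff)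
    show "inj_on j (carrier Q)"
      using inj_onD[OF inj] by (auto intro!: inj_onI simp: j_eq) (auto simp: Qc)
    show "j ` carrier Q = kernel Z S p"
    proof (intro equalityI subsetI)
      fix z assume "z \<in> j ` carrier Q"
      then obtain c u where cu: "(c, u) \<in> carrier Q" and z: "z = ((i c, \<one>\<^bsub>S\<^esub>), u)"
        using j_eq by fastforce
      then have "z \<in> carrier Z" using mor_closed[OF j cu] by (simp add: j_eq)
      then show "z \<in> kernel Z S p" using z p_eq by (simp add: kernel_def)
    next
      fix z assume "z \<in> kernel Z S p"
      then obtain x t u where z: "z = ((x, t), u)" and zZ: "((x, t), u) \<in> carrier Z"
        and "p ((x, t), u) = \<one>\<^bsub>S\<^esub>"
        by (cases z; cases "fst z") (auto simp: kernel_def)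
      then have t: "t = \<one>\<^bsub>S\<^esub>" by (simp add: p_eq)
      then have "x \<in> kernel X ?R \<pi>" using zZ by (simp add: Zc kernel_def)
      then obtain c where c: "c \<in> carrier ?P" "x = i c" unfolding ker[symmetric] by blast
      then have "(c, u) \<in> carrier Q" using zZ by (simp add: Zc Qc \<tau>i)
      then show "z \<in> j ` carrier Q" using c t z j_eq by (force simp: image_iff)
    qed
  qed
  moreover have "induced_action \<Omega> Q Z S j s
      (act (pullback_xmod S \<phi> M)) (star (pullback_xmod S \<phi> M))"
    unfolding induced_action_def
  proof (intro conjI ballI)
    fix t q assume t: "t \<in> carrier S" and qQ: "q \<in> carrier Q"
    then obtain c u where q: "q = (c, u)" and cu: "c \<in> carrier ?P" "u \<in> carrier S" "?d c = \<phi> u"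
      by (auto simp: Qc)
    have act: "act M (\<phi> t) c \<in> carrier ?P"
      "i (act M (\<phi> t) c) = \<sigma> (\<phi> t) \<otimes>\<^bsub>X\<^esub> i c \<otimes>\<^bsub>X\<^esub> inv\<^bsub>X\<^esub> (\<sigma> (\<phi> t))"
      using ia t cu(1) by (auto simp: induced_action_def)
    have act_q: "act (pullback_xmod S \<phi> M) t q = (act M (\<phi> t) c, t \<otimes>\<^bsub>S\<^esub> u \<otimes>\<^bsub>S\<^esub> inv\<^bsub>S\<^esub> t)"
      by (simp add: pullback_xmod_def q)
    show cl: "act (pullback_xmod S \<phi> M) t q \<in> carrier Q"
      using t cu act by (simp add: act_q Qc d_act)
    have jq: "j (act (pullback_xmod S \<phi> M) t q) =
        ((i (act M (\<phi> t) c), \<one>\<^bsub>S\<^esub>), t \<otimes>\<^bsub>S\<^esub> u \<otimes>\<^bsub>S\<^esub> inv\<^bsub>S\<^esub> t)"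
      unfolding act_q by (rule j_eq) (rule cl[unfolded act_q])
    have "inv\<^bsub>Z\<^esub> (s t) = s (inv\<^bsub>S\<^esub> t)"
      using group_hom.hom_inv[OF mor_group_hom[OF S Z s] t] by simp
    then show "j (act (pullback_xmod S \<phi> M) t q) = s t \<otimes>\<^bsub>Z\<^esub> j q \<otimes>\<^bsub>Z\<^esub> inv\<^bsub>Z\<^esub> (s t)"
      using t qQ unfolding jq by (simp add: q j_eq s_eq act) (simp add: Z_def Y_def)
  next
    fix m t q assume m: "m \<in> bin \<Omega>" and t: "t \<in> carrier S" and qQ: "q \<in> carrier Q"
    then obtain c u where q: "q = (c, u)" and cu: "c \<in> carrier ?P" "u \<in> carrier S" "?d c = \<phi> u"
      by (auto simp: Qc)
    have star: "star M m (\<phi> t) c \<in> carrier ?P"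
      "i (star M m (\<phi> t) c) = bop X m (\<sigma> (\<phi> t)) (i c)"
      using ia t cu(1) m by (auto simp: induced_action_def)
    have star_q: "star (pullback_xmod S \<phi> M) m t q = (star M m (\<phi> t) c, bop S m t u)"
      by (simp add: pullback_xmod_def q)
    show cl: "star (pullback_xmod S \<phi> M) m t q \<in> carrier Q"
      using t cu m star by (simp add: star_q Qc d_star object_bop_closed[OF S] mor_bop[OF \<phi>])
    have jq: "j (star (pullback_xmod S \<phi> M) m t q) =
        ((i (star M m (\<phi> t) c), \<one>\<^bsub>S\<^esub>), bop S m t u)"
      unfolding star_q by (rule j_eq) (rule cl[unfolded star_q])
    show "j (star (pullback_xmod S \<phi> M) m t q) = bop Z m (s t) (j q)"
      using t qQ m unfolding jq by (simp add: q j_eq s_eq star)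
        (simp add: Z_def Y_def bop_one_right[OF S])
  qed
  ultimately have "derived_action \<Omega> E Q S (act (pullback_xmod S \<phi> M)) (star (pullback_xmod S \<phi> M))"
    using derived_actionI[OF over] by blast
  then show ?thesis by (simp add: pullback_xmod_def Q_def)
qed

text \<open>
  The second crossed module condition transfers because \<open>(c, u)\<close> in the fibre product acts
  through \<open>\<phi> u\<close>, which equals \<open>\<partial> c\<close>.
\<close>

theorem pullback_crossed_module:
  assumes M: "crossed_module \<Omega> E M" and S: "object \<Omega> E S" and \<phi>: "\<phi> \<in> mor \<Omega> S (cod M)"
  shows "crossed_module \<Omega> E (pullback_xmod S \<phi> M)"
proof -
  let ?R = "cod M" and ?P = "dom M" and ?d = "bd M"
  let ?Q = "fibre_product ?P S ?d \<phi>"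
  note P = crossed_module_dom[OF M] and R = crossed_module_cod[OF M] and d = crossed_module_bd[OF M]
    and peiffer_act = crossed_module_peiffer_act[OF M]
    and peiffer_star = crossed_module_peiffer_star[OF M]
  have closed: "act (pullback_xmod S \<phi> M) t q \<in> carrier ?Q"
    "m \<in> bin \<Omega> \<Longrightarrow> star (pullback_xmod S \<phi> M) m t q \<in> carrier ?Q"
    if "t \<in> carrier S" "q \<in> carrier ?Q" for m t q
    using derived_action_act_closed[OF pullback_derived_action[OF M S \<phi>]]
      derived_action_star_closed[OF pullback_derived_action[OF M S \<phi>]] that
    by (simp_all add: pullback_xmod_def del: fibre_product_simps)
  show ?thesis
    unfolding crossed_module_def
  proof (intro conjI ballI)
    show "derived_action \<Omega> E (dom (pullback_xmod S \<phi> M)) (cod (pullback_xmod S \<phi> M))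
        (act (pullback_xmod S \<phi> M)) (star (pullback_xmod S \<phi> M))"
      using pullback_derived_action[OF M S \<phi>] by (simp add: pullback_xmod_def)
    show "object \<Omega> E (dom (pullback_xmod S \<phi> M))"
      using fibre_product_object[OF P S R d \<phi> identities_over] by (simp add: pullback_xmod_def)
    show "object \<Omega> E (cod (pullback_xmod S \<phi> M))" using S by (simp add: pullback_xmod_def)
    show "bd (pullback_xmod S \<phi> M) \<in> mor \<Omega> (dom (pullback_xmod S \<phi> M)) (cod (pullback_xmod S \<phi> M))"
      using fibre_snd_mor[OF P S R d \<phi>] by (simp add: pullback_xmod_def)
  next
    fix t q assume "t \<in> carrier (cod (pullback_xmod S \<phi> M))" "q \<in> carrier (dom (pullback_xmod S \<phi> M))"
    then have tq: "t \<in> carrier S" "q \<in> carrier ?Q" by (simp_all add: pullback_xmod_def)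
    show "bd (pullback_xmod S \<phi> M) (act (pullback_xmod S \<phi> M) t q) =
      t \<otimes>\<^bsub>cod (pullback_xmod S \<phi> M)\<^esub> bd (pullback_xmod S \<phi> M) q \<otimes>\<^bsub>cod (pullback_xmod S \<phi> M)\<^esub>
        inv\<^bsub>cod (pullback_xmod S \<phi> M)\<^esub> t"
      using closed(1)[OF tq] tq by (auto simp: pullback_xmod_def)
    fix m assume "m \<in> bin \<Omega>"
    then show "bd (pullback_xmod S \<phi> M) (star (pullback_xmod S \<phi> M) m t q) =
        bop (cod (pullback_xmod S \<phi> M)) m t (bd (pullback_xmod S \<phi> M) q)"
      using closed(2)[OF tq] tq by (auto simp: pullback_xmod_def)
  next
    fix q q' assume "q \<in> carrier (dom (pullback_xmod S \<phi> M))" "q' \<in> carrier (dom (pullback_xmod S \<phi> M))"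
    then have q: "q \<in> carrier ?Q" "q' \<in> carrier ?Q" by (simp_all add: pullback_xmod_def)
    show "act (pullback_xmod S \<phi> M) (bd (pullback_xmod S \<phi> M) q) q' =
      q \<otimes>\<^bsub>dom (pullback_xmod S \<phi> M)\<^esub> q' \<otimes>\<^bsub>dom (pullback_xmod S \<phi> M)\<^esub>
        inv\<^bsub>dom (pullback_xmod S \<phi> M)\<^esub> q"
      using q fibre_product_inv[OF P S R d \<phi> q(1)]
      by (auto simp: pullback_xmod_def simp flip: peiffer_act)
    fix m assume "m \<in> bin \<Omega>"
    then show "star (pullback_xmod S \<phi> M) m (bd (pullback_xmod S \<phi> M) q) q' =
        bop (dom (pullback_xmod S \<phi> M)) m q q'"
      using q by (auto simp: pullback_xmod_def simp flip: peiffer_star)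
  qed
qed

end


section \<open>The pullback functor\<close>

lemma pullback_arr_simps:
  "snd (pullback_arr S \<phi> M N F) = idm S"
  "fst (pullback_arr S \<phi> M N F) =
    (\<lambda>q\<in>carrier (fibre_product (dom M) S (bd M) \<phi>). (fst F (fst q), snd q))"
  by (auto simp: pullback_arr_def pullback_xmod_def split_beta fun_eq_iff)

context modified_category_of_interest
begin

lemma pullback_arr_xmod_mor:
  assumes M: "crossed_module \<Omega> E M" and N: "crossed_module \<Omega> E N" "cod N = cod M"
    and S: "object \<Omega> E S" and \<phi>: "\<phi> \<in> mor \<Omega> S (cod M)"
    and F: "F \<in> xmod_mor \<Omega> M N" "snd F = idm (cod M)"
  shows "pullback_arr S \<phi> M N F \<in> xmod_mor \<Omega> (pullback_xmod S \<phi> M) (pullback_xmod S \<phi> N)"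
proof -
  let ?R = "cod M"
  let ?QM = "fibre_product (dom M) S (bd M) \<phi>" and ?QN = "fibre_product (dom N) S (bd N) \<phi>"
  obtain f where f: "F = (f, idm ?R)" using F(2) by (cases F) auto
  note PM = crossed_module_dom[OF M] and R = crossed_module_cod[OF M] and dM = crossed_module_bd[OF M]
  note PN = crossed_module_dom[OF N(1)] and dN = crossed_module_bd[OF N(1), unfolded N(2)]
  have fm: "f \<in> mor \<Omega> (dom M) (dom N)"
    and f_bd: "\<And>c. c \<in> carrier (dom M) \<Longrightarrow> bd N (f c) = bd M c"
    and f_act: "\<And>r c. r \<in> carrier ?R \<Longrightarrow> c \<in> carrier (dom M) \<Longrightarrow> f (act M r c) = act N r (f c)"
    and f_star: "\<And>m r c. m \<in> bin \<Omega> \<Longrightarrow> r \<in> carrier ?R \<Longrightarrow> c \<in> carrier (dom M) \<Longrightarrow>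
      f (star M m r c) = star N m r (f c)"
    using F(1) mor_closed[OF dM] by (auto simp: f xmod_mor_def idm_def)
  have Q: "object \<Omega> E ?QM"
    by (rule fibre_product_object[OF PM S R dM \<phi> identities_over])
  have closed: "act (pullback_xmod S \<phi> M) t q \<in> carrier ?QM"
    "m \<in> bin \<Omega> \<Longrightarrow> star (pullback_xmod S \<phi> M) m t q \<in> carrier ?QM"
    if "t \<in> carrier S" "q \<in> carrier ?QM" for m t q
    using derived_action_act_closed[OF pullback_derived_action[OF M S \<phi>]]
      derived_action_star_closed[OF pullback_derived_action[OF M S \<phi>]] that
    by (simp_all add: pullback_xmod_def del: fibre_product_simps)
  have "fst (pullback_arr S \<phi> M N F) =
      fibre_pair ?QM (compose (carrier ?QM) f (fibre_fst (dom M) S (bd M) \<phi>))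
        (fibre_snd (dom M) S (bd M) \<phi>)"
    by (auto simp: pullback_arr_simps f fibre_pair_def compose_def fun_eq_iff)
  also have "\<dots> \<in> mor \<Omega> ?QM ?QN"
    by (rule fibre_pair_mor[OF PN S R dN \<phi>
          compose_mor[OF Q fibre_fst_mor[OF PM S R dM \<phi>] fm] fibre_snd_mor[OF PM S R dM \<phi>] Q])
      (auto simp: compose_def f_bd)
  finally have mor: "fst (pullback_arr S \<phi> M N F) \<in> mor \<Omega> ?QM ?QN" .
  have arr: "fst (pullback_arr S \<phi> M N F) (c, t) = (f c, t)" if "(c, t) \<in> carrier ?QM" for c t
    using that by (simp add: pullback_arr_simps f)
  have "(fst (pullback_arr S \<phi> M N F), idm S) \<in> xmod_mor \<Omega> (pullback_xmod S \<phi> M) (pullback_xmod S \<phi> N)"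
    unfolding xmod_mor_def mem_Collect_eq prod.case
  proof (intro conjI ballI)
    show "fst (pullback_arr S \<phi> M N F) \<in> mor \<Omega> (dom (pullback_xmod S \<phi> M)) (dom (pullback_xmod S \<phi> N))"
      using mor by (simp add: pullback_xmod_def)
    show "idm S \<in> mor \<Omega> (cod (pullback_xmod S \<phi> M)) (cod (pullback_xmod S \<phi> N))"
      using idm_mor[OF S] by (simp add: pullback_xmod_def)
  next
    fix q assume "q \<in> carrier (dom (pullback_xmod S \<phi> M))"
    then have "q \<in> carrier ?QM" by (simp add: pullback_xmod_def)
    then show "bd (pullback_xmod S \<phi> N) (fst (pullback_arr S \<phi> M N F) q) =
        idm S (bd (pullback_xmod S \<phi> M) q)"
      by (auto simp: pullback_xmod_def pullback_arr_simps f f_bd mor_closed[OF fm] idm_def)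
  next
    fix t q assume "t \<in> carrier (cod (pullback_xmod S \<phi> M))" "q \<in> carrier (dom (pullback_xmod S \<phi> M))"
    then have t: "t \<in> carrier S" and q: "q \<in> carrier ?QM" by (simp_all add: pullback_xmod_def)
    obtain c u where cu: "q = (c, u)" "c \<in> carrier (dom M)" using q by auto
    show "fst (pullback_arr S \<phi> M N F) (act (pullback_xmod S \<phi> M) t q) =
        act (pullback_xmod S \<phi> N) (idm S t) (fst (pullback_arr S \<phi> M N F) q)"
      using closed(1)[OF t q] q t cu
      by (simp add: pullback_xmod_def pullback_arr_simps f idm_def f_act mor_closed[OF \<phi>])
    fix m assume m: "m \<in> bin \<Omega>"
    show "fst (pullback_arr S \<phi> M N F) (star (pullback_xmod S \<phi> M) m t q) =
        star (pullback_xmod S \<phi> N) m (idm S t) (fst (pullback_arr S \<phi> M N F) q)"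
      using closed(2)[OF t q m] q t cu m
      by (simp add: pullback_xmod_def pullback_arr_simps f idm_def f_star mor_closed[OF \<phi>])
  qed
  then show ?thesis by (metis pullback_arr_simps(1) prod.collapse)
qed

theorem pullback_functor:
  fixes R :: "('r, 'u, 'b) ogroup" and S :: "('s, 'u, 'b) ogroup"
  assumes S: "object \<Omega> E S" and \<phi>: "\<phi> \<in> mor \<Omega> S R"
  shows "is_functor (XMod_over \<Omega> E R :: (('p, 'r, 'u, 'b) xmod, _) category) (XMod_over \<Omega> E S)
    (pullback_xmod S \<phi>) (pullback_arr S \<phi>)"
  unfolding is_functor_def
proof (intro conjI ballI XMod_over_category)
  fix M :: "('p, 'r, 'u, 'b) xmod" assume M: "M \<in> Ob (XMod_over \<Omega> E R)"
  then show "pullback_xmod S \<phi> M \<in> Ob (XMod_over \<Omega> E S)"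
    using pullback_crossed_module[OF _ S, of M \<phi>] \<phi> by (auto simp: pullback_xmod_def)
  show "pullback_arr S \<phi> M M (Id (XMod_over \<Omega> E R) M) = Id (XMod_over \<Omega> E S) (pullback_xmod S \<phi> M)"
    by (auto simp: prod_eq_iff pullback_arr_simps pullback_xmod_def idm_def fun_eq_iff)
next
  fix M N :: "('p, 'r, 'u, 'b) xmod" and F
  assume "M \<in> Ob (XMod_over \<Omega> E R)" "N \<in> Ob (XMod_over \<Omega> E R)" "F \<in> Hom (XMod_over \<Omega> E R) M N"
  then show "pullback_arr S \<phi> M N F \<in> Hom (XMod_over \<Omega> E S) (pullback_xmod S \<phi> M) (pullback_xmod S \<phi> N)"
    using pullback_arr_xmod_mor[of M N S \<phi> F] S \<phi> by (auto simp: pullback_arr_simps)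
next
  fix M N L :: "('p, 'r, 'u, 'b) xmod" and F G
  assume F: "F \<in> Hom (XMod_over \<Omega> E R) M N"
  have "bd N (fst F c) = bd M c" if "c \<in> carrier (dom M)" "bd M c = \<phi> t" "t \<in> carrier S" for c t
    using F that mor_closed[OF \<phi>] by (auto simp: xmod_mor_def idm_def)
  moreover have "fst F c \<in> carrier (dom N)" if "c \<in> carrier (dom M)" for c
    using F that by (auto simp: xmod_mor_def mor_closed)
  ultimately show "pullback_arr S \<phi> M L (Comp (XMod_over \<Omega> E R) M N L G F) =
      Comp (XMod_over \<Omega> E S) (pullback_xmod S \<phi> M) (pullback_xmod S \<phi> N) (pullback_xmod S \<phi> L)
        (pullback_arr S \<phi> N L G) (pullback_arr S \<phi> M N F)"
    by (auto simp: prod_eq_iff pullback_arr_simps pullback_xmod_def compose_def fun_eq_iff idm_def)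
qed

end

theorem corollary4p2:
  fixes \<Omega> :: "('u, 'b) signature"
    and E :: "('u, 'b) identity set"
    and S :: "('s, 'u, 'b) ogroup"
    and R :: "('r, 'u, 'b) ogroup"
    and \<phi> :: "'s \<Rightarrow> 'r"
  assumes "modified_category_of_interest \<Omega> E"
    and "object \<Omega> E S"
    and "object \<Omega> E R"
    and "\<phi> \<in> mor \<Omega> S R"
  shows "is_functor
           (XMod_over \<Omega> E R :: (('p, 'r, 'u, 'b) xmod, ('p \<Rightarrow> 'p) \<times> ('r \<Rightarrow> 'r)) category)
           (XMod_over \<Omega> E S :: (('p \<times> 's, 's, 'u, 'b) xmod,
              ('p \<times> 's \<Rightarrow> 'p \<times> 's) \<times> ('s \<Rightarrow> 's)) category)
           (pullback_xmod S \<phi>) (pullback_arr S \<phi>)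
       \<and> (\<forall>M :: ('p, 'r, 'u, 'b) xmod. crossed_module \<Omega> E M \<and> cod M = R \<longrightarrow>
            pullback_square TYPE('t) \<Omega> E
              (dom (pullback_xmod S \<phi> M)) (dom M) S R
              (pullback_proj S \<phi> M) (bd (pullback_xmod S \<phi> M)) (bd M) \<phi>)"
proof (intro conjI allI impI)
  interpret modified_category_of_interest \<Omega> E by fact
  show "is_functor (XMod_over \<Omega> E R :: (('p, 'r, 'u, 'b) xmod, _) category)
      (XMod_over \<Omega> E S) (pullback_xmod S \<phi>) (pullback_arr S \<phi>)"
    using assms(2,4) by (rule pullback_functor)
  fix M :: "('p, 'r, 'u, 'b) xmod" assume M: "crossed_module \<Omega> E M \<and> cod M = R"
  then have "object \<Omega> E (dom M)" "bd M \<in> mor \<Omega> (dom M) R" by (auto simp: crossed_module_def)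
  then have "pullback_square TYPE('t) \<Omega> E (fibre_product (dom M) S (bd M) \<phi>) (dom M) S R
      (fibre_fst (dom M) S (bd M) \<phi>) (fibre_snd (dom M) S (bd M) \<phi>) (bd M) \<phi>"
    using assms(2-4) identities_over by (intro fibre_product_pullback_square)
  then show "pullback_square TYPE('t) \<Omega> E (dom (pullback_xmod S \<phi> M)) (dom M) S R
      (pullback_proj S \<phi> M) (bd (pullback_xmod S \<phi> M)) (bd M) \<phi>"
    by (simp add: pullback_xmod_def pullback_proj_def)
qed

end
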